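(* Let $X=P\,\partial_x+Q\,\partial_y$ be a planar polynomial vector field ($P,Q\in\mathbb{C}[x,y]$) and let $\Gamma:\ y-\varphi(x)=0$ be an algebraic invariant curve of $X$. Assume that the first variational equation $\mathrm{VE}_1$ of $X$ along $\Gamma$ has an irregular singular point at infinity. If $X$ is rationally integrable, then for every $k\ge 1$ the Galois group $G_k$ of the linearised variational equation $\mathrm{LVE}_k$ along $\Gamma$ is abelian.
   Context: **Foliation and invariant curve.** Put $f=Q/P$. That $\Gamma:\ y=\varphi(x)$ is an invariant (integral) curve of $X$ means that $\varphi$ is a solution of the associated foliation equation $y'=f(x,y)$ (here $'=d/dx$, and $P(x,\varphi(x))\not\equiv 0$); $\Gamma$ algebraic means that $\varphi$ is an algebraic function. **Variational equations.** Let $\beta_j(x)=\frac{\partial^j f}{\partial y^j}(x,\varphi(x))$, $j\ge 1$. Substituting $y=\varphi+\sum_{j\ge1}\frac{\varepsilon^j}{j!}\varphi_j$ in $y'=f(x,y)$ and equating the coefficients of $\varepsilon,\dots,\varepsilon^k$ gives the $k$-th variational equation $\mathrm{VE}_k$ for $(\varphi_1,\dots,\varphi_k)$: $$\varphi_1'=\beta_1\varphi_1,\quad \varphi_2'=\beta_1\varphi_2+\beta_2\varphi_1^2,\quad \varphi_3'=\beta_1\varphi_3+3\beta_2\varphi_1\varphi_2+\beta_3\varphi_1^3,\ \dots,\ \varphi_k'=\beta_1\varphi_k+\cdots+\beta_k\varphi_1^k .$$ **Linearised variational equation $\mathrm{LVE}_k$.** It is the homogeneous linear system satisfied by the monomials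 $\varphi_1^{m_1}\cdots\varphi_k^{m_k}$ with $\sum_i i\,m_i=k$, taken as new unknowns. Thus $\mathrm{LVE}_1=\mathrm{VE}_1$; $\mathrm{LVE}_2$, with $\chi_1=\varphi_1^2,\ \chi_2=\varphi_2$, is $\chi_1'=2\beta_1\chi_1$, $\chi_2'=\beta_1\chi_2+\beta_2\chi_1$; $\mathrm{LVE}_3$, with $\chi_1=\varphi_1^3$, $\chi_2=\varphi_1\varphi_2$, $\chi_3=\varphi_3$, is $\chi_1'=3\beta_1\chi_1$, $\chi_2'=2\beta_1\chi_2+\beta_2\chi_1$, $\chi_3'=\beta_1\chi_3+3\beta_2\chi_2+\beta_3\chi_1$. **Irregular singular point.** A linear system with a pole at $x=0$, written $x^hY'=B(x)Y$ with $B$ holomorphic at $0$ and $h\in\mathbb{N}$ (minimal), has an irregular singular point at $x=0$ if $h>1$; equivalently its solutions exhibit exponential growth there. The point at infinity is treated via $t=1/x$. **Galois group.** $G_k$ is the differential Galois group (Picard--Vessiot theory) of $\mathrm{LVE}_k$, a linear algebraic group over $\mathbb{C}$, the coefficient field being the field of rational functions on $\Gamma$, i.e. $\mathbb{C}(x,\varphi(x))$ (which is $\mathbb{C}(x)$ if $\varphi$ is rational). **Rational integrability.** $X$ is rationally integrable if there exist independent, pairwise commuting rational vector fields $X=X_1,\dots,X_r$ and independent rational functions $f_1,\dots,f_l$ that are first integrals of all of these vector fields, with $r+l=2$; that is, either there is a rational vector field $X_2$ independent of $X$ with $[X,X_2]=0$, or $X$ has a non-constant rational first integral. *)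

theory Defs
  imports
    "HOL-Complex_Analysis.Complex_Analysis"
    "HOL-Computational_Algebra.Computational_Algebra"
    "HOL-Computational_Algebra.Field_as_Ring"
    "HOL-Combinatorics.Multiset_Permutations"
    "HOL-Algebra.Bij"
begin

section \<open>Bivariate polynomials and rational functions\<close>

text \<open>
  An element of \<^typ>\<open>complex poly poly\<close> is a polynomial in \<open>y\<close> whose coefficients are
  polynomials in \<open>x\<close>.  Its fraction field is the field \<open>C(x,y)\<close>.
\<close>

type_synonym ratfun = "complex poly poly fract"

definition eval2 :: "(complex \<Rightarrow> 'a::comm_semiring_1) \<Rightarrow> complex poly poly \<Rightarrow> 'a \<Rightarrow> 'a \<Rightarrow> 'a" where
  "eval2 c F a b = poly (map_poly (\<lambda>p. poly (map_poly c p) a) F) b"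

text \<open>
  The value of a rational function is taken from its reduced fraction, so it is the expected
  one as soon as some representing fraction has a denominator not vanishing at \<open>(a,b)\<close>.
\<close>

definition eval_ratfun :: "(complex \<Rightarrow> 'a::field) \<Rightarrow> ratfun \<Rightarrow> 'a \<Rightarrow> 'a \<Rightarrow> 'a" where
  "eval_ratfun c r a b = eval2 c (fst (quot_of_fract r)) a b / eval2 c (snd (quot_of_fract r)) a b"

definition derivation :: "('a::comm_ring_1 \<Rightarrow> 'a) \<Rightarrow> bool" where
  "derivation d \<longleftrightarrow> (\<forall>a b. d (a + b) = d a + d b) \<and> (\<forall>a b. d (a * b) = d a * b + a * d b)"

text \<open>Extension of a derivation to the fraction field by the quotient rule.\<close>

definition fract_deriv ::
  "('a::{ring_gcd, idom_divide, semiring_gcd_mult_normalize} \<Rightarrow> 'a) \<Rightarrow> 'a fract \<Rightarrow> 'a fract" where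
  "fract_deriv d r = (case quot_of_fract r of (a, b) \<Rightarrow> Fract (d a * b - a * d b) (b * b))"

lemma fract_deriv_Fract:
  assumes d: "derivation d" and b: "b \<noteq> 0"
  shows "fract_deriv d (Fract a b) = Fract (d a * b - a * d b) (b * b)"
proof -
  obtain p q where pq: "quot_of_fract (Fract a b) = (p, q)" by force
  have q: "q \<noteq> 0"
    using snd_quot_of_fract_nonzero[of "Fract a b"] pq by simp
  have eq: "Fract p q = Fract a b"
    using Fract_quot_of_fract[of "Fract a b"] pq by simp
  hence e: "p * b = a * q" using b q by (simp add: eq_fract)
  hence "d (p * b) = d (a * q)" by simp
  hence de: "d p * b + p * d b = d a * q + a * d q"
    using d by (simp add: derivation_def)
  have "(d p * q - p * d q) * (b * b) - (d a * b - a * d b) * (q * q)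
      = (d p * b + p * d b - (d a * q + a * d q)) * (b * q)
        - d b * q * (p * b - a * q) - d q * b * (p * b - a * q)"
    by (simp add: algebra_simps)
  also have "\<dots> = 0" using e de by simp
  finally have "(d p * q - p * d q) * (b * b) = (d a * b - a * d b) * (q * q)" by simp
  thus ?thesis using b q by (simp add: fract_deriv_def pq eq_fract)
qed

lemma derivation_pderiv: "derivation (pderiv :: 'a::idom poly \<Rightarrow> _)"
  by (simp add: derivation_def pderiv_add pderiv_mult algebra_simps)

lemma derivation_map_poly:
  fixes d :: "'a::comm_ring_1 \<Rightarrow> 'a"
  assumes d: "derivation d"
  shows "derivation (map_poly d)"
proof -
  have add: "d (a + b) = d a + d b" and mult: "d (a * b) = d a * b + a * d b" for a b
    using d by (auto simp: derivation_def)
  have d0 [simp]: "d 0 = 0" using add[of 0 0] by simp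
  have dsum: "d (sum g A) = (\<Sum>i\<in>A. d (g i))" for g :: "nat \<Rightarrow> 'a" and A
    by (induction A rule: infinite_finite_induct) (auto simp: add)
  show ?thesis
    unfolding derivation_def
    by (auto intro!: poly_eqI simp: coeff_map_poly coeff_mult add dsum mult sum.distrib)
qed

definition ddx :: "ratfun \<Rightarrow> ratfun" where
  "ddx = fract_deriv (map_poly pderiv)"

definition ddy :: "ratfun \<Rightarrow> ratfun" where
  "ddy = fract_deriv pderiv"


section \<open>Rational vector fields and rational integrability\<close>

text \<open>The pair \<open>(A, B)\<close> stands for the vector field \<open>A \<partial>\<^sub>x + B \<partial>\<^sub>y\<close>.\<close>

type_synonym vfield = "ratfun \<times> ratfun"

definition vf_apply :: "vfield \<Rightarrow> ratfun \<Rightarrow> ratfun" where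
  "vf_apply X H = fst X * ddx H + snd X * ddy H"

definition lie_bracket :: "vfield \<Rightarrow> vfield \<Rightarrow> vfield" where
  "lie_bracket X Y = (vf_apply X (fst Y) - vf_apply Y (fst X), vf_apply X (snd Y) - vf_apply Y (snd X))"

definition vf_independent :: "vfield \<Rightarrow> vfield \<Rightarrow> bool" where
  "vf_independent X Y \<longleftrightarrow>
     (\<forall>a b. a * fst X + b * fst Y = 0 \<and> a * snd X + b * snd Y = 0 \<longrightarrow> a = 0 \<and> b = 0)"

definition rationally_integrable :: "vfield \<Rightarrow> bool" where
  "rationally_integrable X \<longleftrightarrow>
     (\<exists>Y. vf_independent X Y \<and> lie_bracket X Y = (0, 0)) \<or>
     (\<exists>H. (\<forall>c :: complex. H \<noteq> Fract [:[:c:]:] 1) \<and> vf_apply X H = 0)"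


section \<open>Algebraic invariant curves\<close>

definition vanishes_on_graph :: "complex set \<Rightarrow> (complex \<Rightarrow> complex) \<Rightarrow> complex poly poly \<Rightarrow> bool" where
  "vanishes_on_graph U \<phi> F \<longleftrightarrow> (\<forall>z\<in>U. eval2 (\<lambda>w. w) F z (\<phi> z) = 0)"

text \<open>A (possibly multivalued) algebraic function is given by one of its holomorphic branches.\<close>

definition algebraic_function_on :: "complex set \<Rightarrow> (complex \<Rightarrow> complex) \<Rightarrow> bool" where
  "algebraic_function_on U \<phi> \<longleftrightarrow> open U \<and> connected U \<and> U \<noteq> {} \<and> \<phi> holomorphic_on U \<and>
     (\<exists>F. F \<noteq> 0 \<and> vanishes_on_graph U \<phi> F)"

definition invariant_graph ::
  "complex poly poly \<Rightarrow> complex poly poly \<Rightarrow> complex set \<Rightarrow> (complex \<Rightarrow> complex) \<Rightarrow> bool" where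
  "invariant_graph P Q U \<phi> \<longleftrightarrow> \<not> vanishes_on_graph U \<phi> P \<and>
     (\<forall>z\<in>U. eval2 (\<lambda>w. w) P z (\<phi> z) \<noteq> 0 \<longrightarrow>
        (\<phi> has_field_derivative
           eval2 (\<lambda>w. w) Q z (\<phi> z) / eval2 (\<lambda>w. w) P z (\<phi> z)) (at z))"


section \<open>Irregular singular points at infinity\<close>

text \<open>
  For the scalar equation \<open>dY/ds = b(s) Y\<close>, written \<open>s\<^sup>h dY/ds = B(s) Y\<close> with \<open>B\<close> holomorphic at
  \<open>s = 0\<close> and \<open>h\<close> minimal.
\<close>

definition irregular_singular_at_0 :: "complex fls \<Rightarrow> bool" where
  "irregular_singular_at_0 b \<longleftrightarrow> (LEAST h :: nat. 0 \<le> fls_subdegree (fls_X ^ h * b)) > 1"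

text \<open>
  A branch at infinity of the algebraic curve \<open>\<Gamma>\<close> with branch \<open>\<phi>\<close>: a Puiseux parametrisation
  \<open>x = s\<^sup>-\<^sup>e\<close>, \<open>y = \<psi>(s)\<close> along which every polynomial vanishing on \<open>\<Gamma>\<close> vanishes.
  For \<open>e = 1\<close> the parameter \<open>s\<close> is \<open>t = 1/x\<close>.  The series \<open>\<psi>\<close> is algebraic over \<open>C(s)\<close>, hence
  convergent.
\<close>

definition branch_at_infinity ::
  "complex set \<Rightarrow> (complex \<Rightarrow> complex) \<Rightarrow> nat \<Rightarrow> complex fls \<Rightarrow> bool" where
  "branch_at_infinity U \<phi> e \<psi> \<longleftrightarrow> e \<ge> 1 \<and>
     (\<forall>F. vanishes_on_graph U \<phi> F \<longrightarrow> eval2 fls_const F (fls_X_inv ^ e) \<psi> = 0)"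

text \<open>
  In the parameter \<open>s\<close> the equation \<open>dY/dx = \<beta>\<^sub>1 Y\<close> becomes \<open>dY/ds = (dx/ds) \<beta>\<^sub>1 Y\<close>.
\<close>

definition VE1_irregular_at_infinity :: "ratfun \<Rightarrow> complex set \<Rightarrow> (complex \<Rightarrow> complex) \<Rightarrow> bool" where
  "VE1_irregular_at_infinity f U \<phi> \<longleftrightarrow>
     (\<exists>e \<psi>. branch_at_infinity U \<phi> e \<psi> \<and>
        irregular_singular_at_0
          (fls_deriv (fls_X_inv ^ e) * eval_ratfun fls_const (ddy f) (fls_X_inv ^ e) \<psi>))"


section \<open>Variational equations\<close>

text \<open>
  The right-hand side of the \<open>i\<close>-th variational equation: the coefficient of \<open>\<epsilon>\<^sup>i / i!\<close> in
  \<open>f(x, \<phi> + u)\<close>, where \<open>f(x, \<phi> + u)\<close> has Taylor coefficients \<open>\<beta> n / n!\<close> and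
  \<open>u = \<Sum>\<^sub>j \<phi>\<^sub>j \<epsilon>\<^sup>j / j!\<close>.
\<close>

definition VE_rhs :: "(nat \<Rightarrow> 'a::field_char_0) \<Rightarrow> (nat \<Rightarrow> 'a) \<Rightarrow> nat \<Rightarrow> 'a" where
  "VE_rhs \<beta> y i = fact i * fps_nth
     (fps_compose (Abs_fps (\<lambda>n. \<beta> n / fact n)) (Abs_fps (\<lambda>j. if j = 0 then 0 else y j / fact j))) i"

text \<open>
  The monomial \<open>\<phi>\<^sub>1\<^sup>m\<^sup>1 \<dots> \<phi>\<^sub>k\<^sup>m\<^sup>k\<close> is encoded by the multiset in which \<open>i\<close> occurs \<open>m\<^sub>i\<close> times; the
  condition \<open>\<Sum>\<^sub>i i m\<^sub>i = k\<close> says that this multiset is a partition of \<open>k\<close>.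
\<close>

definition monomials :: "nat \<Rightarrow> nat multiset set" where
  "monomials k = {m. 0 \<notin># m \<and> sum_mset m = k}"

definition monomial_value :: "(nat \<Rightarrow> 'a::comm_monoid_mult) \<Rightarrow> nat multiset \<Rightarrow> 'a" where
  "monomial_value y m = prod_mset (image_mset y m)"

text \<open>
  The coefficient of \<open>\<beta>\<^bsub>size p\<^esub> \<phi>\<^sup>p\<close> in the variational equation for \<open>\<phi>\<^sub>i\<close>, where \<open>p\<close> is a
  partition of \<open>i\<close> (see \<open>VE_rhs_eq\<close> below).
\<close>

definition VE_coeff :: "nat multiset \<Rightarrow> 'a::field_char_0" where
  "VE_coeff p = fact (sum_mset p) / (\<Prod>j\<in>set_mset p. fact (count p j) * fact j ^ count p j)"

text \<open>
  Entry \<open>(m, n)\<close> of the matrix of \<open>LVE\<^sub>k\<close>: the coefficient of \<open>\<phi>\<^sup>n\<close> in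
  \<open>(\<phi>\<^sup>m)' = \<Sum>\<^sub>i m\<^sub>i \<phi>\<^bsup>m - e\<^sub>i\<^esup> \<phi>\<^sub>i'\<close> (see \<open>LVE_matrix_monomials\<close> below).
\<close>

definition LVE_matrix :: "(nat \<Rightarrow> 'a::field_char_0) \<Rightarrow> nat multiset \<Rightarrow> nat multiset \<Rightarrow> 'a" where
  "LVE_matrix \<beta> m n =
     (\<Sum>i\<in>set_mset m. of_nat (count m i) *
        (\<Sum>p\<in>{p \<in> monomials i. m - {#i#} + p = n}. VE_coeff p * \<beta> (size p)))"

lemma monomials_size_le: "m \<in> monomials k \<Longrightarrow> size m \<le> k"
proof (induction m arbitrary: k)
  case (add x m)
  hence "x \<ge> 1" "m \<in> monomials (k - x)" "x \<le> k" by (auto simp: monomials_def)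
  with add.IH[of "k - x"] show ?case by simp
qed simp

lemma finite_monomials [simp]: "finite (monomials k)"
proof (rule finite_subset)
  show "monomials k \<subseteq> mset ` {xs. set xs \<subseteq> {..k} \<and> length xs \<le> k}"
  proof
    fix m assume m: "m \<in> monomials k"
    obtain xs where xs: "m = mset xs" using ex_mset[of m] by blast
    have "x \<le> k" if "x \<in> set xs" for x
      using m that xs by (auto simp: monomials_def sum_mset_sum_list member_le_sum_list)
    moreover have "length xs \<le> k" using monomials_size_le[OF m] xs by simp
    ultimately show "m \<in> mset ` {xs. set xs \<subseteq> {..k} \<and> length xs \<le> k}" using xs by auto
  qed
  show "finite (mset ` {xs. set xs \<subseteq> {..k} \<and> length xs \<le> k})"
    by (intro finite_imageI finite_lists_length_le) auto
qed

lemma fps_power_nth_lists: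
  fixes g :: "'a::comm_ring_1 fps"
  shows "fps_nth (g ^ n) i = (\<Sum>v\<in>natpermute i n. prod_list (map (fps_nth g) v))"
proof (cases n)
  case 0
  thus ?thesis by (simp add: natpermute_0)
next
  case (Suc m)
  have "(\<Prod>j = 0..m. fps_nth g (v ! j)) = prod_list (map (fps_nth g) v)"
    if "v \<in> natpermute i n" for v
  proof -
    have "length v = Suc m" using that Suc by (simp add: natpermute_def)
    thus ?thesis
      by (simp add: prod.list_conv_set_nth atLeast0LessThan[symmetric] atLeastLessThanSuc_atLeastAtMost)
  qed
  thus ?thesis using Suc by (simp add: fps_power_nth del: power_Suc)
qed

lemma fps_power_nth_monomials:
  fixes g :: "'a::field_char_0 fps"
  assumes g0: "fps_nth g 0 = 0"
  shows "fps_nth (g ^ n) i =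
    (\<Sum>p\<in>{p \<in> monomials i. size p = n}.
       fact n / (\<Prod>j\<in>set_mset p. fact (count p j)) * monomial_value (fps_nth g) p)"
proof -
  let ?N = "{v \<in> natpermute i n. 0 \<notin> set v}"
  let ?M = "{p \<in> monomials i. size p = n}"
  have "finite (natpermute i n)" by (rule natpermute_finite)
  hence "fps_nth (g ^ n) i = (\<Sum>v\<in>?N. prod_list (map (fps_nth g) v))"
    unfolding fps_power_nth_lists
    by (intro sum.mono_neutral_right) (auto simp: prod_list_zero_iff image_iff, metis g0)
  also have "\<dots> = (\<Sum>p\<in>?M. \<Sum>v\<in>{v \<in> ?N. mset v = p}. prod_list (map (fps_nth g) v))"
  proof (rule sum.group[symmetric])
    show "finite ?N" using natpermute_finite by simp
    show "finite ?M" by simp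
    show "mset ` ?N \<subseteq> ?M" by (auto simp: monomials_def natpermute_def sum_mset_sum_list)
  qed
  also have "\<dots> = (\<Sum>p\<in>?M. fact n / (\<Prod>j\<in>set_mset p. fact (count p j)) * monomial_value (fps_nth g) p)"
  proof (intro sum.cong refl)
    fix p assume p: "p \<in> ?M"
    have eq: "{v \<in> ?N. mset v = p} = permutations_of_multiset p"
    proof (intro equalityI subsetI)
      fix v assume "v \<in> permutations_of_multiset p"
      hence v: "mset v = p" by (simp add: permutations_of_multiset_def)
      have "length v = size p" "sum_list v = sum_mset p" "set v = set_mset p"
        by (simp_all add: v[symmetric] sum_mset_sum_list)
      thus "v \<in> {v \<in> ?N. mset v = p}"
        using p v by (simp add: natpermute_def monomials_def)
    qed (auto simp: permutations_of_multiset_def)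
    have val: "prod_list (map (fps_nth g) v) = monomial_value (fps_nth g) p"
      if "v \<in> permutations_of_multiset p" for v
      using that by (auto simp: permutations_of_multiset_def monomial_value_def prod_mset_prod_list mset_map[symmetric] simp del: mset_map)
    have "(\<Sum>v\<in>{v \<in> ?N. mset v = p}. prod_list (map (fps_nth g) v))
        = of_nat (card (permutations_of_multiset p)) * monomial_value (fps_nth g) p"
      unfolding eq by (simp add: val)
    moreover have "(of_nat (card (permutations_of_multiset p)) :: 'a)
                     * (\<Prod>j\<in>set_mset p. fact (count p j)) = fact n"
    proof -
      have "of_nat (card (permutations_of_multiset p) * (\<Prod>j\<in>set_mset p. fact (count p j)))
              = (of_nat (fact (size p)) :: 'a)"
        by (simp only: card_permutations_of_multiset_aux)
      thus ?thesis using p by simp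
    qed
    hence "(of_nat (card (permutations_of_multiset p)) :: 'a)
             = fact n / (\<Prod>j\<in>set_mset p. fact (count p j))"
      by (simp add: field_simps)
    ultimately show "(\<Sum>v\<in>{v \<in> ?N. mset v = p}. prod_list (map (fps_nth g) v))
      = fact n / (\<Prod>j\<in>set_mset p. fact (count p j)) * monomial_value (fps_nth g) p" by simp
  qed
  finally show ?thesis .
qed

lemma VE_rhs_eq:
  assumes i: "i \<ge> 1"
  shows "VE_rhs \<beta> y i = (\<Sum>p\<in>monomials i. VE_coeff p * \<beta> (size p) * monomial_value y p)"
proof -
  let ?g = "Abs_fps (\<lambda>j. if j = 0 then 0 else y j / fact j)"
  let ?t = "\<lambda>p. \<beta> (size p) / (\<Prod>j\<in>set_mset p. fact (count p j)) * monomial_value (fps_nth ?g) p"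
  have "VE_rhs \<beta> y i = fact i * (\<Sum>n = 0..i. \<beta> n / fact n * fps_nth (?g ^ n) i)"
    by (simp add: VE_rhs_def fps_compose_nth)
  also have "(\<Sum>n = 0..i. \<beta> n / fact n * fps_nth (?g ^ n) i)
      = (\<Sum>n = 0..i. \<Sum>p\<in>{p \<in> monomials i. size p = n}. ?t p)"
  proof (intro sum.cong refl)
    fix n
    show "\<beta> n / fact n * fps_nth (?g ^ n) i = (\<Sum>p\<in>{p \<in> monomials i. size p = n}. ?t p)"
      by (subst fps_power_nth_monomials) (auto simp: sum_distrib_left intro!: sum.cong)
  qed
  also have "\<dots> = (\<Sum>p\<in>monomials i. ?t p)"
    by (rule sum.group) (auto dest: monomials_size_le)
  also have "fact i * \<dots> = (\<Sum>p\<in>monomials i. VE_coeff p * \<beta> (size p) * monomial_value y p)"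
    unfolding sum_distrib_left
  proof (intro sum.cong refl)
    fix p assume p: "p \<in> monomials i"
    have "image_mset (fps_nth ?g) p = image_mset (\<lambda>j. y j / fact j) p"
      using p by (intro image_mset_cong) (auto simp: monomials_def)
    hence "monomial_value (fps_nth ?g) p = prod_mset (image_mset (\<lambda>j. y j / fact j) p)"
      by (simp only: monomial_value_def)
    also have "\<dots> = monomial_value y p / prod_mset (image_mset fact p)"
      unfolding monomial_value_def by (induction p) auto
    also have "prod_mset (image_mset fact p) = (\<Prod>j\<in>set_mset p. fact j ^ count p j :: 'a)"
      by (simp only: image_prod_mset_multiplicity)
    finally have mv: "monomial_value (fps_nth ?g) p
      = monomial_value y p / (\<Prod>j\<in>set_mset p. fact j ^ count p j)" .
    have "VE_coeff p = (fact i / ((\<Prod>j\<in>set_mset p. fact (count p j))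
            * (\<Prod>j\<in>set_mset p. fact j ^ count p j)) :: 'a)"
      using p by (simp add: VE_coeff_def monomials_def prod.distrib)
    thus "fact i * ?t p = VE_coeff p * \<beta> (size p) * monomial_value y p"
      unfolding mv by simp
  qed
  finally show ?thesis .
qed

lemma sum_mset_image_count:
  fixes h :: "'b \<Rightarrow> 'a::comm_semiring_1"
  shows "(\<Sum>i\<in>#m. h i) = (\<Sum>i\<in>set_mset m. of_nat (count m i) * h i)"
proof (induction m)
  case (add x m)
  have *: "(\<Sum>i\<in>insert x (set_mset m). of_nat (count (add_mset x m) i) * h i)
      = (\<Sum>i\<in>insert x (set_mset m). of_nat (count m i) * h i + (if i = x then h x else 0))"
    by (intro sum.cong) (auto simp: algebra_simps)
  have "(\<Sum>i\<in>insert x (set_mset m). of_nat (count m i) * h i)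
      = (\<Sum>i\<in>set_mset m. of_nat (count m i) * h i)"
    by (intro sum.mono_neutral_right) (auto simp: not_in_iff)
  thus ?case using add * by (simp add: sum.distrib add.commute)
qed simp

lemma derivation_prod_mset:
  assumes d: "derivation d"
  shows "d (monomial_value y m) =
    (\<Sum>i\<in>set_mset m. of_nat (count m i) * (monomial_value y (m - {#i#}) * d (y i)))"
proof -
  have add: "d (a + b) = d a + d b" and mult: "d (a * b) = d a * b + a * d b" for a b
    using d by (auto simp: derivation_def)
  have d1: "d 1 = 0" using mult[of 1 1] by simp
  have "d (monomial_value y m) = (\<Sum>i\<in>#m. monomial_value y (m - {#i#}) * d (y i))"
  proof (induction m)
    case empty
    thus ?case by (simp add: monomial_value_def d1)
  next
    case (add x m)
    have "monomial_value y (add_mset x m - {#i#}) = y x * monomial_value y (m - {#i#})"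
      if "i \<in># m" for i
    proof -
      have "add_mset x m - {#i#} = add_mset x (m - {#i#})"
        using multi_member_split[OF that] by (auto simp: add_mset_commute[of x])
      thus ?thesis by (simp add: monomial_value_def)
    qed
    hence "(\<Sum>i\<in>#m. monomial_value y (add_mset x m - {#i#}) * d (y i))
         = (\<Sum>i\<in>#m. y x * (monomial_value y (m - {#i#}) * d (y i)))"
      by (intro arg_cong[where f = sum_mset] image_mset_cong) (simp add: mult.assoc)
    also have "\<dots> = y x * d (monomial_value y m)"
      by (simp add: add.IH sum_mset_distrib_left)
    finally show ?case
      by (simp add: monomial_value_def mult algebra_simps)
  qed
  also have "\<dots> = (\<Sum>i\<in>set_mset m. of_nat (count m i) * (monomial_value y (m - {#i#}) * d (y i)))"
    by (rule sum_mset_image_count)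
  finally show ?thesis .
qed

lemma LVE_matrix_monomials:
  assumes d: "derivation d"
    and VE: "\<And>i. 1 \<le> i \<Longrightarrow> i \<le> k \<Longrightarrow> d (y i) = VE_rhs \<beta> y i"
    and m: "m \<in> monomials k"
  shows "d (monomial_value y m) = (\<Sum>n\<in>monomials k. LVE_matrix \<beta> m n * monomial_value y n)"
proof -
  have step: "monomial_value y (m - {#i#}) * d (y i)
      = (\<Sum>n\<in>monomials k. (\<Sum>p\<in>{p \<in> monomials i. m - {#i#} + p = n}. VE_coeff p * \<beta> (size p))
           * monomial_value y n)" if i: "i \<in># m" for i
  proof -
    obtain m' where m': "m = add_mset i m'" using multi_member_split[OF i] by blast
    hence m'_eq: "m - {#i#} = m'" by simp
    have km: "0 \<notin># m'" "i \<noteq> 0" "i + sum_mset m' = k"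
      using m unfolding m' monomials_def by auto
    have ik: "1 \<le> i" "i \<le> k" using km by linarith+
    have "d (y i) = (\<Sum>p\<in>monomials i. VE_coeff p * \<beta> (size p) * monomial_value y p)"
      using VE[OF ik] VE_rhs_eq[OF ik(1)] by (rule trans)
    hence "monomial_value y (m - {#i#}) * d (y i)
        = (\<Sum>p\<in>monomials i. monomial_value y (m - {#i#}) * (VE_coeff p * \<beta> (size p) * monomial_value y p))"
      by (simp only: sum_distrib_left)
    also have "\<dots> = (\<Sum>p\<in>monomials i. VE_coeff p * \<beta> (size p) * monomial_value y (m - {#i#} + p))"
      by (intro sum.cong refl) (simp only: monomial_value_def image_mset_union prod_mset_Un mult_ac)
    also have "\<dots> = (\<Sum>n\<in>monomials k. \<Sum>p\<in>{p \<in> monomials i. m - {#i#} + p = n}.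
                       VE_coeff p * \<beta> (size p) * monomial_value y (m - {#i#} + p))"
    proof (rule sum.group[symmetric])
      show "(\<lambda>p. m - {#i#} + p) ` monomials i \<subseteq> monomials k"
        unfolding m'_eq using km by (auto simp: monomials_def)
    qed simp_all
    also have "\<dots> = (\<Sum>n\<in>monomials k.
        (\<Sum>p\<in>{p \<in> monomials i. m - {#i#} + p = n}. VE_coeff p * \<beta> (size p)) * monomial_value y n)"
      by (intro sum.cong refl) (simp add: sum_distrib_right)
    finally show ?thesis .
  qed
  have "d (monomial_value y m) =
    (\<Sum>i\<in>set_mset m. of_nat (count m i) * (monomial_value y (m - {#i#}) * d (y i)))"
    by (rule derivation_prod_mset[OF d])
  also have "\<dots> = (\<Sum>i\<in>set_mset m. \<Sum>n\<in>monomials k. of_nat (count m i) *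
      ((\<Sum>p\<in>{p \<in> monomials i. m - {#i#} + p = n}. VE_coeff p * \<beta> (size p)) * monomial_value y n))"
    by (intro sum.cong refl) (simp add: step sum_distrib_left)
  also have "\<dots> = (\<Sum>n\<in>monomials k. LVE_matrix \<beta> m n * monomial_value y n)"
    by (subst sum.swap) (simp add: LVE_matrix_def sum_distrib_right mult.assoc)
  finally show ?thesis .
qed

section \<open>The differential field of rational functions on the curve\<close>

definition is_subfield :: "'a::field set \<Rightarrow> bool" where
  "is_subfield S \<longleftrightarrow> 0 \<in> S \<and> 1 \<in> S \<and>
     (\<forall>a\<in>S. \<forall>b\<in>S. a + b \<in> S \<and> a - b \<in> S \<and> a * b \<in> S) \<and> (\<forall>a\<in>S. inverse a \<in> S)"

text \<open>
  A copy of the differential field \<open>C(x, \<phi>(x))\<close> inside a differential field \<open>('a, \<delta>)\<close>: the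
  constants are embedded by \<open>c\<close>, and \<open>(\<xi>, \<eta>)\<close> satisfies exactly the polynomial relations
  of \<open>(x, \<phi>(x))\<close>, so that \<open>R(x, \<phi>(x)) \<mapsto> R(\<xi>, \<eta>)\<close> is a well-defined isomorphism of
  fields onto \<open>curve_field c \<xi> \<eta>\<close>.  It is differential because \<open>\<delta>\<close> kills \<open>C\<close>, \<open>\<delta> \<xi> = 1\<close>, and
  derivations extend uniquely to algebraic extensions in characteristic 0.
\<close>

definition realizes_curve_field ::
  "complex set \<Rightarrow> (complex \<Rightarrow> complex) \<Rightarrow> ('a::field_char_0 \<Rightarrow> 'a) \<Rightarrow> (complex \<Rightarrow> 'a) \<Rightarrow> 'a \<Rightarrow> 'a \<Rightarrow> bool" where
  "realizes_curve_field U \<phi> \<delta> c \<xi> \<eta> \<longleftrightarrow> derivation \<delta> \<and>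
     c 1 = 1 \<and> (\<forall>z w. c (z + w) = c z + c w \<and> c (z * w) = c z * c w) \<and>
     (\<forall>z. \<delta> (c z) = 0) \<and> \<delta> \<xi> = 1 \<and>
     (\<forall>F. eval2 c F \<xi> \<eta> = 0 \<longleftrightarrow> vanishes_on_graph U \<phi> F)"

definition curve_field :: "(complex \<Rightarrow> 'a::field) \<Rightarrow> 'a \<Rightarrow> 'a \<Rightarrow> 'a set" where
  "curve_field c \<xi> \<eta> = is_subfield hull (range c \<union> {\<xi>, \<eta>})"

text \<open>\<open>\<beta>\<^sub>j = (\<partial>\<^sup>j f / \<partial> y\<^sup>j)(x, \<phi>(x))\<close>\<close>

definition beta :: "ratfun \<Rightarrow> (complex \<Rightarrow> 'a::field) \<Rightarrow> 'a \<Rightarrow> 'a \<Rightarrow> nat \<Rightarrow> 'a" where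
  "beta f c \<xi> \<eta> j = eval_ratfun c ((ddy ^^ j) f) \<xi> \<eta>"

text \<open>Laurent expansion at any point \<open>z0\<close> of \<open>U\<close> is one such realization.\<close>

lemma eval2_pCons:
  assumes "c 0 = 0"
  shows "eval2 c (pCons p F) a b = poly (map_poly c p) a + b * eval2 c F a b"
  using assms by (simp add: eval2_def map_poly_pCons)

lemma eval2_has_fps_expansion:
  assumes \<phi>: "(\<lambda>w. \<phi> (z0 + w)) has_fps_expansion g"
  shows "\<exists>G. (\<lambda>w. eval2 (\<lambda>w. w) F (z0 + w) (\<phi> (z0 + w))) has_fps_expansion G \<and>
             eval2 fls_const F (fls_const z0 + fls_X) (fps_to_fls g) = fps_to_fls G"
proof (induction F)
  case 0
  thus ?case by (intro exI[of _ 0]) (simp add: eval2_def)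
next
  case (pCons p F)
  then obtain G where G: "(\<lambda>w. eval2 (\<lambda>w. w) F (z0 + w) (\<phi> (z0 + w))) has_fps_expansion G"
      "eval2 fls_const F (fls_const z0 + fls_X) (fps_to_fls g) = fps_to_fls G" by blast
  have "\<exists>H. (\<lambda>w. poly (map_poly (\<lambda>w. w) p) (z0 + w)) has_fps_expansion H \<and>
          poly (map_poly fls_const p) (fls_const z0 + fls_X) = fps_to_fls H"
  proof (induction p)
    case 0
    thus ?case by (intro exI[of _ 0]) simp
  next
    case (pCons a p)
    then obtain H where H: "(\<lambda>w. poly (map_poly (\<lambda>w. w) p) (z0 + w)) has_fps_expansion H"
          "poly (map_poly fls_const p) (fls_const z0 + fls_X) = fps_to_fls H" by blast
    show ?case
      by (rule exI[of _ "fps_const a + (fps_const z0 + fps_X) * H"])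
         (auto simp: map_poly_pCons H(2) fls_times_fps_to_fls
               intro!: has_fps_expansion_add has_fps_expansion_mult H(1)[simplified] fps_expansion_intros)
  qed
  then obtain H where H: "(\<lambda>w. poly (map_poly (\<lambda>w. w) p) (z0 + w)) has_fps_expansion H"
     "poly (map_poly fls_const p) (fls_const z0 + fls_X) = fps_to_fls H" by blast
  show ?case
    by (rule exI[of _ "H + g * G"])
       (auto simp: eval2_pCons H(2) G(2) fls_times_fps_to_fls
             intro!: has_fps_expansion_add has_fps_expansion_mult H(1)[simplified] G(1) \<phi>)
qed

lemma eval2_holomorphic:
  assumes "\<phi> holomorphic_on U"
  shows "(\<lambda>z. eval2 (\<lambda>w. w) F z (\<phi> z)) holomorphic_on U"
  by (induction F) (auto simp: eval2_pCons eval2_def[of _ 0] intro!: holomorphic_intros assms)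

lemma realizes_curve_field_fls:
  assumes U: "open U" "connected U" "z0 \<in> U" and \<phi>: "\<phi> holomorphic_on U"
  shows "realizes_curve_field U \<phi> fls_deriv fls_const (fls_const z0 + fls_X)
           (fps_to_fls (fps_expansion \<phi> z0))"
proof -
  have exp: "(\<lambda>w. \<phi> (z0 + w)) has_fps_expansion fps_expansion \<phi> z0"
    using U \<phi> by (intro analytic_at_imp_has_fps_expansion) (auto simp: analytic_at)
  have "eval2 fls_const F (fls_const z0 + fls_X) (fps_to_fls (fps_expansion \<phi> z0)) = 0
          \<longleftrightarrow> vanishes_on_graph U \<phi> F" for F
  proof -
    let ?h = "\<lambda>z. eval2 (\<lambda>w. w) F z (\<phi> z)"
    obtain G where G: "(\<lambda>w. ?h (z0 + w)) has_fps_expansion G"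
      "eval2 fls_const F (fls_const z0 + fls_X) (fps_to_fls (fps_expansion \<phi> z0)) = fps_to_fls G"
      using eval2_has_fps_expansion[OF exp] by blast
    have "G = 0 \<longleftrightarrow> (\<forall>z\<in>U. ?h z = 0)"
    proof
      assume "G = 0"
      hence "eventually (\<lambda>w. ?h (z0 + w) = 0) (nhds 0)"
        using G(1) by (simp add: has_fps_expansion_def)
      hence "eventually (\<lambda>z. ?h z = 0) (nhds z0)"
        by (simp add: nhds_to_0' eventually_filtermap)
      then obtain S where S: "open S" "z0 \<in> S" "\<And>z. z \<in> S \<Longrightarrow> ?h z = 0"
        by (auto simp: eventually_nhds)
      show "\<forall>z\<in>U. ?h z = 0"
      proof
        fix z assume "z \<in> U"
        show "?h z = 0"
          by (rule analytic_continuation_open[of "S \<inter> U" U ?h "\<lambda>_. 0" z])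
             (use S U \<open>z \<in> U\<close> in \<open>auto intro!: eval2_holomorphic \<phi>\<close>)
      qed
    next
      assume z: "\<forall>z\<in>U. ?h z = 0"
      have "eventually (\<lambda>z. z \<in> U) (nhds z0)" using U by (simp add: eventually_nhds_in_open)
      hence "eventually (\<lambda>z. ?h z = 0) (nhds z0)" by eventually_elim (use z in auto)
      hence "eventually (\<lambda>w. ?h (z0 + w) = 0) (nhds 0)"
        by (simp add: nhds_to_0' eventually_filtermap)
      hence "(\<lambda>w. ?h (z0 + w)) has_fps_expansion 0"
        by (simp add: has_fps_expansion_def)
      thus "G = 0" using G(1) by (metis fps_expansion_unique_complex)
    qed
    thus ?thesis using G(2) by (simp add: vanishes_on_graph_def)
  qed
  thus ?thesis
    by (simp add: realizes_curve_field_def derivation_def fls_plus_const fls_const_mult_const algebra_simps)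
qed


section \<open>Picard--Vessiot extensions and differential Galois groups\<close>

text \<open>
  \<open>L\<close> is a Picard--Vessiot extension of \<open>K\<close> for the linear system \<open>\<delta> Y\<^sub>i = \<Sum>\<^sub>l A\<^sub>i\<^sub>l Y\<^sub>l\<close> indexed by
  the finite set \<open>I\<close>: it is generated over \<open>K\<close> by the entries of a fundamental matrix \<open>F\<close> and
  has no constants outside \<open>K\<close>.
\<close>

definition picard_vessiot ::
  "('a::field \<Rightarrow> 'a) \<Rightarrow> 'a set \<Rightarrow> 'i set \<Rightarrow> ('i \<Rightarrow> 'i \<Rightarrow> 'a) \<Rightarrow> 'a set \<Rightarrow> bool" where
  "picard_vessiot \<delta> K I A L \<longleftrightarrow>
     (\<forall>a\<in>L. \<delta> a \<in> L) \<and> {a \<in> L. \<delta> a = 0} = {a \<in> K. \<delta> a = 0} \<and>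
     (\<exists>F. (\<forall>i\<in>I. \<forall>j\<in>I. \<delta> (F i j) = (\<Sum>l\<in>I. A i l * F l j)) \<and>
          (\<exists>G. \<forall>i\<in>I. \<forall>j\<in>I. (\<Sum>l\<in>I. F i l * G l j) = (if i = j then 1 else 0) \<and>
                            (\<Sum>l\<in>I. G i l * F l j) = (if i = j then 1 else 0)) \<and>
          L = is_subfield hull (K \<union> {F i j | i j. i \<in> I \<and> j \<in> I}))"

definition diff_galois_group :: "('a::field \<Rightarrow> 'a) \<Rightarrow> 'a set \<Rightarrow> 'a set \<Rightarrow> ('a \<Rightarrow> 'a) monoid" where
  "diff_galois_group \<delta> K L = (BijGroup L)\<lparr>carrier :=
     {\<sigma> \<in> Bij L. (\<forall>a\<in>L. \<forall>b\<in>L. \<sigma> (a + b) = \<sigma> a + \<sigma> b \<and> \<sigma> (a * b) = \<sigma> a * \<sigma> b) \<and>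
                (\<forall>a\<in>L. \<sigma> (\<delta> a) = \<delta> (\<sigma> a)) \<and> (\<forall>a\<in>K. \<sigma> a = a)}\<rparr>"

end

theory Submission
  imports Defs
begin

text \<open>
  The proof works in the coordinate \<open>u = y - \<eta>\<close> transversal to the curve. Expanding rational functions
  at the curve turns \<open>C(x,y)\<close> into a subfield of \<open>K((u))\<close>, where \<open>K\<close> is the field of rational functions on
  \<open>\<Gamma>\<close>, and turns \<open>X / P\<close> into the derivation \<open>D = \<delta> + w \<partial>\<^sub>u\<close> with \<open>w = \<Sum>\<^sub>j \<beta>\<^sub>j u\<^sup>j / j!\<close>, \<open>j \<ge> 1\<close>
  (\<open>D_taylor\<close>, \<open>taylor_f\<close>).
  
  Irregularity enters through one fact, \<open>no_exponential_in_K\<close>: for \<open>n \<noteq> 0\<close> the equation \<open>g' = n \<beta>\<^sub>1 g\<close> has only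
  the zero solution in \<open>K\<close>. Indeed a Puiseux branch at infinity embeds \<open>K\<close> into \<open>C((s))\<close>, where logarithmic
  derivatives have at most simple poles. Consequently, if \<open>D F = m w' F\<close> with \<open>m\<close> an integer and \<open>F\<close> a
  nonzero series over \<open>K\<close>, then the lowest exponent of \<open>F\<close> equals \<open>m\<close> and the lowest coefficient is a
  constant (\<open>lowest_term\<close>).
  
  For \<open>m = 0\<close> this excludes rational first integrals. So an integrable \<open>X\<close> has a commuting rational field
  \<open>(A, B)\<close>, and removing from it a multiple of \<open>X\<close> leaves the vertical field \<open>G \<partial>\<^sub>u\<close> with \<open>G = B - f A\<close>. It
  satisfies \<open>D G = w' G\<close>, so \<open>m = 1\<close> applies, and \<open>G = u + \<dots>\<close> after multiplication by a constant
  (\<open>infinitesimal_symmetry\<close>).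
  
  The field \<open>G \<partial>\<^sub>u\<close> has a simple zero with eigenvalue 1 and is linearised by the series
  \<open>\<psi> = v + \<dots>\<close> over \<open>K\<close> with \<open>v \<psi>' = G(\<psi>)\<close>. Because \<open>D\<close> commutes with \<open>G \<partial>\<^sub>u\<close>, the same substitution \<open>u = \<psi>(v)\<close>
  linearises the foliation: it becomes \<open>v' = \<beta>\<^sub>1 v\<close> (\<open>flow_linearises\<close>). On the monomials of weight \<open>k\<close> the
  substitution acts by a unitriangular matrix over \<open>K\<close>, which therefore brings \<open>LVE\<^sub>k\<close> to diagonal form, the
  entry for a monomial of degree \<open>r\<close> being \<open>r \<beta>\<^sub>1\<close> (\<open>LVE_diagonalisable\<close>).
  
  A Picard--Vessiot extension of a diagonal system is generated by exponentials, which every element of the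
  Galois group multiplies by constants; such automorphisms commute (\<open>comm_group_diff_galois_group\<close>).
\<close>

unbundle fps_syntax

section \<open>Evaluating polynomials and rational functions in a field\<close>

text \<open>
  Three copies of the constants occur below: in the given differential field, in the Laurent series at
  infinity, and in the Laurent series transversal to the curve.
\<close>

locale const_hom =
  fixes c :: "complex \<Rightarrow> 'b::field"
  assumes c_one: "c 1 = 1"
    and c_add: "c (z + w) = c z + c w"
    and c_mult: "c (z * w) = c z * c w"
begin

lemma c_zero: "c 0 = 0"
  using c_add[of 0 0] by (metis add_cancel_right_right add.right_neutral)

lemmas map_poly_c_pCons = map_poly_pCons[of c, OF c_zero]
lemmas eval2_c_pCons = eval2_pCons[of c, OF c_zero]

lemma eval1_add: "poly (map_poly c (p + q)) a = poly (map_poly c p) a + poly (map_poly c q) a"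
proof (induction p arbitrary: q)
  case (pCons x p)
  obtain y q' where q: "q = pCons y q'" by (cases q)
  show ?case
    unfolding q add_pCons map_poly_c_pCons
    by (simp add: pCons.IH c_add algebra_simps)
qed simp

lemma eval1_smult: "poly (map_poly c (smult z p)) a = c z * poly (map_poly c p) a"
  by (induction p) (simp_all add: map_poly_pCons c_zero c_mult algebra_simps)

lemma eval1_mult: "poly (map_poly c (p * q)) a = poly (map_poly c p) a * poly (map_poly c q) a"
proof (induction p)
  case (pCons x p)
  show ?case
    unfolding mult_pCons_left eval1_add eval1_smult map_poly_c_pCons
    by (simp add: pCons.IH algebra_simps c_zero)
qed simp

lemma eval2_0 [simp]: "eval2 c 0 a b = 0"
  by (simp add: eval2_def)

lemma eval2_const: "eval2 c [:p:] a b = poly (map_poly c p) a"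
  by (simp add: eval2_pCons c_zero)

lemma eval2_1 [simp]: "eval2 c 1 a b = 1"
  by (simp add: one_pCons eval2_const map_poly_pCons c_zero c_one)

lemma eval2_add: "eval2 c (F + G) a b = eval2 c F a b + eval2 c G a b"
proof (induction F arbitrary: G)
  case (pCons p F)
  obtain q G' where G: "G = pCons q G'" by (cases G)
  show ?case
    unfolding G add_pCons eval2_c_pCons
    by (simp add: pCons.IH eval1_add algebra_simps)
qed simp

lemma eval2_smult: "eval2 c (smult p F) a b = poly (map_poly c p) a * eval2 c F a b"
  by (induction F) (simp_all add: eval2_pCons c_zero eval1_mult algebra_simps)

lemma eval2_mult: "eval2 c (F * G) a b = eval2 c F a b * eval2 c G a b"
proof (induction F)
  case (pCons p F)
  show ?case
    unfolding mult_pCons_left eval2_add eval2_smult eval2_c_pCons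
    by (simp add: pCons.IH algebra_simps)
qed simp

lemma eval2_uminus: "eval2 c (- F) a b = - eval2 c F a b"
  using eval2_add[of F "- F" a b] by (simp add: eq_neg_iff_add_eq_0 add.commute)

lemma eval2_diff: "eval2 c (F - G) a b = eval2 c F a b - eval2 c G a b"
  using eval2_add[of F "- G" a b] by (simp add: eval2_uminus)

lemma eval2_of_int: "eval2 c (of_int n) a b = of_int n"
proof -
  have nat: "eval2 c (of_nat m) a b = of_nat m" for m
    by (induction m) (simp_all add: eval2_add)
  show ?thesis
    by (cases n rule: int_cases2) (simp_all add: nat eval2_uminus)
qed

text \<open>
  The value is defined by the reduced fraction; the reduced denominator divides \<open>G\<close>, so it does not vanish
  where \<open>G\<close> does not.
\<close>

lemma eval_ratfun_Fract:
  assumes "eval2 c G a b \<noteq> 0"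
  shows "eval_ratfun c (Fract F G) a b = eval2 c F a b / eval2 c G a b"
proof -
  obtain p q where pq: "quot_of_fract (Fract F G) = (p, q)" by force
  have G: "G \<noteq> 0" using assms by auto
  have q: "q \<noteq> 0" using snd_quot_of_fract_nonzero[of "Fract F G"] pq by simp
  have "Fract p q = Fract F G" using Fract_quot_of_fract[of "Fract F G"] pq by simp
  hence e: "p * G = F * q" using G q by (simp add: eq_fract)
  have "coprime q p" using coprime_quot_of_fract[of "Fract F G"] pq by (simp add: coprime_commute)
  moreover have "q dvd p * G" using e by simp
  ultimately have "q dvd G" by (simp add: coprime_dvd_mult_right_iff)
  hence "eval2 c q a b \<noteq> 0" using assms by (auto simp: eval2_mult)
  moreover have "eval2 c p a b * eval2 c G a b = eval2 c F a b * eval2 c q a b"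
    using e by (metis eval2_mult)
  ultimately show ?thesis
    using assms by (simp add: eval_ratfun_def pq field_simps)
qed

lemma derivation_eval2:
  assumes d: "derivation d" and dc: "\<And>z. d (c z) = 0"
  shows "d (eval2 c F a b) = eval2 c (map_poly pderiv F) a b * d a + eval2 c (pderiv F) a b * d b"
proof -
  have add: "d (x + y) = d x + d y" and mult: "d (x * y) = d x * y + x * d y" for x y
    using d by (auto simp: derivation_def)
  have d0: "d 0 = 0" using add[of 0 0] by (metis add_cancel_right_right add.right_neutral)
  have one: "d (poly (map_poly c p) a) = poly (map_poly c (pderiv p)) a * d a" for p
  proof (induction p)
    case (pCons x p)
    show ?case
      unfolding pderiv_pCons map_poly_c_pCons eval1_add
      by (simp add: add mult dc pCons.IH c_zero algebra_simps)
  qed (simp add: d0)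
  show ?thesis
  proof (induction F)
    case (pCons p F)
    have "map_poly pderiv (pCons p F) = pCons (pderiv p) (map_poly pderiv F)"
      by (simp add: map_poly_pCons)
    thus ?case
      unfolding pderiv_pCons eval2_add
      by (simp add: eval2_pCons c_zero add mult pCons.IH one algebra_simps)
  qed (simp add: d0)
qed

end

lemma derivation_0: "derivation d \<Longrightarrow> d 0 = 0"
  unfolding derivation_def by (metis add_cancel_right_left)

lemma derivation_add: "derivation d \<Longrightarrow> d (a + b) = d a + d b"
  by (simp add: derivation_def)

lemma derivation_mult: "derivation d \<Longrightarrow> d (a * b) = d a * b + a * d b"
  by (simp add: derivation_def)

lemma derivation_1: "derivation d \<Longrightarrow> d 1 = 0"
  using derivation_mult[of d 1 1] by simp

lemma derivation_uminus: "derivation d \<Longrightarrow> d (- a) = - d a"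
  using derivation_add[of d a "- a"] derivation_0[of d] by (simp add: eq_neg_iff_add_eq_0 add.commute)

lemma derivation_diff: "derivation d \<Longrightarrow> d (a - b) = d a - d b"
  using derivation_add[of d a "- b"] derivation_uminus[of d b] by simp

lemma derivation_of_nat: "derivation d \<Longrightarrow> d (of_nat n) = 0"
  by (induction n) (simp_all add: derivation_0 derivation_add derivation_1)

lemma derivation_sum: "derivation d \<Longrightarrow> d (sum g A) = (\<Sum>i\<in>A. d (g i))"
  by (induction A rule: infinite_finite_induct) (simp_all add: derivation_0 derivation_add)

lemma derivation_divide:
  fixes d :: "'a::field \<Rightarrow> 'a"
  assumes d: "derivation d" and b: "b \<noteq> 0"
  shows "d (a / b) = (d a * b - a * d b) / (b * b)"
proof -
  have "d a = d (a / b * b)" using b by simp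
  also have "\<dots> = d (a / b) * b + a / b * d b" by (simp only: derivation_mult[OF d])
  finally show ?thesis using b by (simp add: field_simps)
qed

section \<open>Subfields and Laurent series\<close>

text \<open>
  Summation bounds that are common to several products, whatever the exact subdegrees of the factors are.
\<close>

lemma fls_times_nth_wide:
  fixes f g :: "'a::semiring_0 fls"
  assumes "l \<le> fls_subdegree f" "m \<le> fls_subdegree g"
  shows "(f * g) $$ n = (\<Sum>i=l..n - m. f $$ i * g $$ (n - i))"
  unfolding fls_times_nth(2)
  by (rule sum.mono_neutral_left) (use assms in \<open>auto intro: fls_eq0_below_subdegree\<close>)

definition fls_coeff_deriv :: "('a::comm_ring_1 \<Rightarrow> 'a) \<Rightarrow> 'a fls \<Rightarrow> 'a fls" where
  "fls_coeff_deriv \<delta> f = Abs_fls (\<lambda>n. \<delta> (f $$ n))"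

lemma fls_coeff_deriv_nth:
  assumes "derivation \<delta>"
  shows "fls_coeff_deriv \<delta> f $$ n = \<delta> (f $$ n)"
  unfolding fls_coeff_deriv_def
  by (rule nth_Abs_fls_lower_bound[of "fls_subdegree f"]) (simp add: derivation_0[OF assms])

lemma fls_coeff_deriv_const:
  "derivation \<delta> \<Longrightarrow> fls_coeff_deriv \<delta> (fls_const x) = fls_const (\<delta> x)"
  by (rule fls_eqI) (simp add: fls_coeff_deriv_nth derivation_0)

lemma fls_coeff_deriv_X: "derivation \<delta> \<Longrightarrow> fls_coeff_deriv \<delta> fls_X = 0"
  by (rule fls_eqI) (simp add: fls_coeff_deriv_nth derivation_0 derivation_1)

lemma derivation_fls_coeff_deriv:
  assumes d: "derivation \<delta>"
  shows "derivation (fls_coeff_deriv \<delta>)"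
  unfolding derivation_def
proof (intro conjI allI)
  fix f g :: "'a fls"
  show "fls_coeff_deriv \<delta> (f + g) = fls_coeff_deriv \<delta> f + fls_coeff_deriv \<delta> g"
    by (rule fls_eqI) (simp add: fls_coeff_deriv_nth d derivation_add)
  show "fls_coeff_deriv \<delta> (f * g) = fls_coeff_deriv \<delta> f * g + f * fls_coeff_deriv \<delta> g"
  proof (rule fls_eqI)
    fix n
    let ?l = "min (fls_subdegree f) (fls_subdegree (fls_coeff_deriv \<delta> f))"
    let ?m = "min (fls_subdegree g) (fls_subdegree (fls_coeff_deriv \<delta> g))"
    have "\<delta> (f $$ i * g $$ j) = \<delta> (f $$ i) * g $$ j + f $$ i * \<delta> (g $$ j)" for i j
      by (rule derivation_mult[OF d])
    thus "fls_coeff_deriv \<delta> (f * g) $$ n = (fls_coeff_deriv \<delta> f * g + f * fls_coeff_deriv \<delta> g) $$ n"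
      by (simp add: fls_coeff_deriv_nth[OF d] fls_times_nth_wide[of ?l _ ?m] derivation_sum[OF d]
            sum.distrib)
  qed
qed

text \<open>
  The vector field \<open>\<delta> + w \<partial>\<^sub>u\<close> acting on Laurent series in \<open>u\<close>.
\<close>

definition fls_vf :: "('a::comm_ring_1 \<Rightarrow> 'a) \<Rightarrow> 'a fls \<Rightarrow> 'a fls \<Rightarrow> 'a fls" where
  "fls_vf \<delta> w f = fls_coeff_deriv \<delta> f + w * fls_deriv f"

lemma derivation_fls_deriv: "derivation (fls_deriv :: 'a::comm_ring_1 fls \<Rightarrow> _)"
  by (simp add: derivation_def algebra_simps)

lemma derivation_fls_vf: "derivation \<delta> \<Longrightarrow> derivation (fls_vf \<delta> w)"
  using derivation_fls_coeff_deriv[of \<delta>] derivation_fls_deriv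
  by (simp add: derivation_def fls_vf_def algebra_simps)

lemma fls_vf_const: "derivation \<delta> \<Longrightarrow> fls_vf \<delta> w (fls_const x) = fls_const (\<delta> x)"
  by (simp add: fls_vf_def fls_coeff_deriv_const)

lemma fls_vf_X: "derivation \<delta> \<Longrightarrow> fls_vf \<delta> w fls_X = w"
  by (simp add: fls_vf_def fls_coeff_deriv_X)

lemma is_subfield_hull: "is_subfield (is_subfield hull (S :: 'a::field set))"
proof (rule hull_in)
  fix T :: "'a set set"
  assume "Ball T is_subfield"
  hence "\<And>S. S \<in> T \<Longrightarrow> is_subfield S" by blast
  thus "is_subfield (\<Inter>T)" unfolding is_subfield_def Inter_iff by blast
qed


locale subfield =
  fixes K :: "'a::field_char_0 set"
  assumes K: "is_subfield K"
begin

lemma zero_in [simp, intro]: "0 \<in> K" and one_in [simp, intro]: "1 \<in> K"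
  and add_in [intro]: "a \<in> K \<Longrightarrow> b \<in> K \<Longrightarrow> a + b \<in> K"
  and diff_in [intro]: "a \<in> K \<Longrightarrow> b \<in> K \<Longrightarrow> a - b \<in> K"
  and mult_in [intro]: "a \<in> K \<Longrightarrow> b \<in> K \<Longrightarrow> a * b \<in> K"
  and inverse_in [intro]: "a \<in> K \<Longrightarrow> inverse a \<in> K"
  using K by (auto simp: is_subfield_def)

lemma uminus_in [intro]: "a \<in> K \<Longrightarrow> - a \<in> K"
  using diff_in[OF zero_in] by fastforce

lemma divide_in [intro]: "a \<in> K \<Longrightarrow> b \<in> K \<Longrightarrow> a / b \<in> K"
  by (auto simp: divide_inverse)

lemma of_nat_in [simp, intro]: "of_nat n \<in> K"
  by (induction n) auto

lemma fact_in [simp, intro]: "fact n \<in> K"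
  using of_nat_in[of "fact n"] by simp

lemma sum_in [intro]: "(\<And>i. i \<in> A \<Longrightarrow> f i \<in> K) \<Longrightarrow> sum f A \<in> K"
  by (induction A rule: infinite_finite_induct) auto

lemma prod_in [intro]: "(\<And>i. i \<in> A \<Longrightarrow> f i \<in> K) \<Longrightarrow> prod f A \<in> K"
  by (induction A rule: infinite_finite_induct) auto

lemma power_in [intro]: "a \<in> K \<Longrightarrow> a ^ n \<in> K"
  by (induction n) auto

lemma fps_inverse_in:
  assumes f: "\<And>n. fps_nth f n \<in> K"
  shows "fps_nth (inverse f) n \<in> K"
proof (cases "fps_nth f 0 = 0")
  case True
  thus ?thesis by (simp add: fps_inverse_eq_0)
next
  case False
  show ?thesis
  proof (induction n rule: less_induct)
    case (less n)
    show ?case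
    proof (cases n)
      case 0
      thus ?thesis using f by auto
    next
      case (Suc m)
      have "0 = fps_nth (f * inverse f) n"
        using inverse_mult_eq_1'[OF False] Suc by simp
      also have "\<dots> = fps_nth f 0 * fps_nth (inverse f) n
          + (\<Sum>i=1..n. fps_nth f i * fps_nth (inverse f) (n - i))"
        by (simp add: fps_mult_nth sum.atLeast_Suc_atMost)
      finally have "fps_nth f 0 * fps_nth (inverse f) n
          = - (\<Sum>i=1..n. fps_nth f i * fps_nth (inverse f) (n - i))"
        by (simp add: eq_neg_iff_add_eq_0)
      hence eq: "fps_nth (inverse f) n
          = - (\<Sum>i=1..n. fps_nth f i * fps_nth (inverse f) (n - i)) / fps_nth f 0"
        using False by (simp add: field_simps)
      show ?thesis unfolding eq using f less.IH by fastforce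
    qed
  qed
qed

text \<open>
  Irregularity only speaks about elements of \<open>K\<close>; this closure property keeps the Taylor coefficients of
  rational functions there.
\<close>

lemma is_subfield_fls: "is_subfield {f. \<forall>n. f $$ n \<in> K}"
proof -
  have "inverse f $$ n \<in> K" if f: "\<And>n. f $$ n \<in> K" for f n
    unfolding fls_inverse_def using f
    by (auto intro!: fps_inverse_in)
  thus ?thesis
    by (auto simp: is_subfield_def fls_times_nth(2) intro!: sum_in mult_in)
qed

end

lemma subfield_eval2:
  fixes K :: "'a::field_char_0 set"
  assumes "const_hom c" "is_subfield K" "range c \<subseteq> K" "a \<in> K" "b \<in> K"
  shows "eval2 c F a b \<in> K"
proof -
  interpret const_hom c by fact
  interpret subfield K by unfold_locales fact
  have "poly (map_poly c p) a \<in> K" for p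
    using assms by (induction p) (auto simp: map_poly_pCons c_zero)
  thus ?thesis
    using assms by (induction F) (auto simp: eval2_pCons c_zero)
qed

lemma subfield_eval_ratfun:
  fixes K :: "'a::field_char_0 set"
  assumes "const_hom c" "is_subfield K" "range c \<subseteq> K" "a \<in> K" "b \<in> K"
  shows "eval_ratfun c R a b \<in> K"
proof -
  interpret subfield K by unfold_locales fact
  show ?thesis unfolding eval_ratfun_def using subfield_eval2[OF assms] by blast
qed

lemma const_hom_fls_const: "const_hom (fls_const :: complex \<Rightarrow> _)"
  by unfold_locales (simp_all add: fls_plus_const)

lemma const_hom_fls_const_comp:
  assumes "const_hom c"
  shows "const_hom (\<lambda>z. fls_const (c z))"
proof -
  interpret const_hom c by fact
  show ?thesis by unfold_locales (simp_all add: fls_plus_const c_one c_add c_mult)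
qed

section \<open>The ideal of the curve\<close>

text \<open>
  An element with nonzero derivative is transcendental over the constants, because differentiating an
  algebraic relation gives one of smaller degree.
\<close>

lemma eval1_eq_0_imp_eq_0:
  fixes d :: "'a::field_char_0 \<Rightarrow> 'a"
  assumes h: "const_hom c" and d: "derivation d" and dc: "\<And>z. d (c z) = 0" and a: "d a \<noteq> 0"
    and p: "poly (map_poly c p) a = 0"
  shows "p = 0"
  using p
proof (induction "degree p" arbitrary: p rule: less_induct)
  case (less p)
  interpret const_hom c by (rule h)
  have "eval2 c (map_poly pderiv [:p:]) a b * d a = 0" for b
    using derivation_eval2[OF d dc, of "[:p:]" a b] less.prems
    by (simp add: eval2_const derivation_0[OF d])
  hence 0: "poly (map_poly c (pderiv p)) a = 0"
    using a by (simp add: map_poly_pCons eval2_const)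
  have "degree p = 0"
  proof (rule ccontr)
    assume deg: "degree p \<noteq> 0"
    hence "degree (pderiv p) < degree p" by (simp add: degree_pderiv)
    from less.hyps[OF this 0] deg show False by (simp add: pderiv_eq_0_iff)
  qed
  then obtain z where p: "p = [:z:]" by (rule degree_eq_zeroE)
  have "c z = 0" using less.prems by (simp add: p map_poly_c_pCons)
  hence "z = 0"
    using c_mult[of z "inverse z"] by (cases "z = 0") (auto simp: c_one)
  thus ?case by (simp add: p)
qed

lemma eval2_graph_has_field_derivative:
  fixes \<phi> :: "complex \<Rightarrow> complex"
  assumes "(\<phi> has_field_derivative D) (at z)"
  shows "((\<lambda>z. eval2 (\<lambda>w. w) F z (\<phi> z)) has_field_derivative
      (eval2 (\<lambda>w. w) (map_poly pderiv F) z (\<phi> z) + eval2 (\<lambda>w. w) (pderiv F) z (\<phi> z) * D)) (at z)"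
proof -
  interpret const_hom "\<lambda>w::complex. w" by unfold_locales auto
  show ?thesis
  proof (induction F)
    case (pCons p F)
    have "map_poly pderiv (pCons p F) = pCons (pderiv p) (map_poly pderiv F)"
      by (simp add: map_poly_pCons)
    thus ?case
      unfolding pderiv_pCons eval2_add
      by (auto intro!: derivative_eq_intros assms pCons.IH simp: eval2_c_pCons algebra_simps)
  qed simp
qed

locale realized_curve =
  fixes P Q :: "complex poly poly" and U :: "complex set" and \<phi> :: "complex \<Rightarrow> complex"
    and \<delta> :: "'a::field_char_0 \<Rightarrow> 'a" and c :: "complex \<Rightarrow> 'a" and \<xi> \<eta> :: 'a
  assumes algebraic: "algebraic_function_on U \<phi>"
    and invariant: "invariant_graph P Q U \<phi>"
    and realizes: "realizes_curve_field U \<phi> \<delta> c \<xi> \<eta>"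
begin

abbreviation "ev F \<equiv> eval2 c F \<xi> \<eta>"
abbreviation "K \<equiv> curve_field c \<xi> \<eta>"
abbreviation "f \<equiv> Fract Q P"
abbreviation "\<beta> \<equiv> beta f c \<xi> \<eta>"

sublocale const_hom c
  using realizes by unfold_locales (auto simp: realizes_curve_field_def)

lemma deriv_\<delta>: "derivation \<delta>" and \<delta>_c: "\<delta> (c z) = 0" and \<delta>_\<xi>: "\<delta> \<xi> = 1"
  and ev_eq_0_iff: "ev F = 0 \<longleftrightarrow> vanishes_on_graph U \<phi> F"
  using realizes by (auto simp: realizes_curve_field_def)

lemma ev_P: "ev P \<noteq> 0"
  using invariant by (simp add: ev_eq_0_iff invariant_graph_def)

lemma P_nonzero: "P \<noteq> 0"
  using ev_P by auto

lemma eval1_\<xi>_eq_0_iff: "poly (map_poly c p) \<xi> = 0 \<longleftrightarrow> p = 0"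
  using eval1_eq_0_imp_eq_0[OF const_hom_axioms deriv_\<delta> \<delta>_c, of \<xi> p] by (auto simp: \<delta>_\<xi>)

text \<open>
  The vector field is tangent to the curve. The differential equation for \<open>\<phi>\<close> holds only where \<open>P\<close> does not
  vanish; the extra factor \<open>P\<close> covers the other points, and it cancels because \<open>ev\<close> takes values in a field.
\<close>

lemma ev_tangent:
  assumes "ev F = 0"
  shows "ev (P * map_poly pderiv F + Q * pderiv F) = 0"
proof -
  interpret i: const_hom "\<lambda>w::complex. w" by unfold_locales auto
  let ?e = "\<lambda>F z. eval2 (\<lambda>w. w) F z (\<phi> z)"
  have alg: "d * a + b' * b = 0" if "d \<noteq> 0" "a + b * (b' / d) = 0" for a b b' d :: complex
  proof -
    have "d * a + b' * b = d * (a + b * (b' / d))" using that(1) by (simp add: algebra_simps)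
    thus ?thesis using that(2) by simp
  qed
  have U: "open U" using algebraic by (simp add: algebraic_function_on_def)
  have F: "?e F z = 0" if "z \<in> U" for z
    using assms that by (simp add: ev_eq_0_iff vanishes_on_graph_def)
  have "?e (P * (P * map_poly pderiv F + Q * pderiv F)) z = 0" if z: "z \<in> U" for z
  proof (cases "?e P z = 0")
    case False
    hence D: "(\<phi> has_field_derivative ?e Q z / ?e P z) (at z)"
      using invariant z by (simp add: invariant_graph_def)
    have ev0: "\<forall>\<^sub>F z in nhds z. 0 = ?e F z"
      using eventually_nhds_in_open[OF U z] by eventually_elim (simp add: F)
    have "((\<lambda>z. 0) has_field_derivative
       (?e (map_poly pderiv F) z + ?e (pderiv F) z * (?e Q z / ?e P z))) (at z)"
      using eval2_graph_has_field_derivative[OF D, of F]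
      by (simp only: DERIV_cong_ev[OF refl ev0 refl])
    from DERIV_unique[OF this DERIV_const]
    have "?e (map_poly pderiv F) z + ?e (pderiv F) z * (?e Q z / ?e P z) = 0" .
    hence "?e P z * ?e (map_poly pderiv F) z + ?e Q z * ?e (pderiv F) z = 0"
      using alg[OF False] by metis
    thus ?thesis by (simp only: i.eval2_mult i.eval2_add mult_zero_right)
  qed (simp add: i.eval2_mult)
  hence "ev (P * (P * map_poly pderiv F + Q * pderiv F)) = 0"
    unfolding ev_eq_0_iff vanishes_on_graph_def by blast
  thus ?thesis using ev_P by (simp add: eval2_mult)
qed

text \<open>
  A polynomial of least \<open>y\<close>-degree in the ideal of the curve, hence a multiple, by a factor from \<open>C[x]\<close>, of its equation.
\<close>

definition minpol where
  "minpol = (ARG_MIN degree F. F \<noteq> 0 \<and> ev F = 0)"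

lemma minpol: "minpol \<noteq> 0" "ev minpol = 0"
  and minpol_le: "F \<noteq> 0 \<Longrightarrow> ev F = 0 \<Longrightarrow> degree minpol \<le> degree F"
proof -
  obtain G where G: "G \<noteq> 0 \<and> ev G = 0"
    using algebraic by (auto simp: algebraic_function_on_def ev_eq_0_iff)
  have "minpol \<noteq> 0 \<and> ev minpol = 0"
    unfolding minpol_def by (rule arg_min_natI) (rule G)
  thus "minpol \<noteq> 0" "ev minpol = 0" by auto
  show "F \<noteq> 0 \<Longrightarrow> ev F = 0 \<Longrightarrow> degree minpol \<le> degree F"
    unfolding minpol_def by (rule arg_min_nat_le) auto
qed

lemma degree_minpol: "degree minpol > 0"
proof (rule ccontr)
  assume "\<not> ?thesis"
  then obtain p where "minpol = [:p:]" using degree_eq_zeroE by blast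
  thus False using minpol by (simp add: eval2_const eval1_\<xi>_eq_0_iff)
qed

lemma ev_pderiv_minpol: "ev (pderiv minpol) \<noteq> 0"
proof
  assume "ev (pderiv minpol) = 0"
  moreover have "pderiv minpol \<noteq> 0" using degree_minpol by (simp add: pderiv_eq_0_iff)
  ultimately have "degree minpol \<le> degree (pderiv minpol)" by (intro minpol_le)
  thus False using degree_minpol by (simp add: degree_pderiv)
qed

text \<open>
  The derivation is only prescribed on \<open>\<xi>\<close> and on the constants. Its value on the algebraic element \<open>\<eta>\<close> is found by
  differentiating the minimal relation, whose coefficient of \<open>\<delta> \<eta>\<close> is nonzero.
\<close>

lemma \<delta>_\<eta>: "ev P * \<delta> \<eta> = ev Q"
proof -
  have "ev (map_poly pderiv minpol) + ev (pderiv minpol) * \<delta> \<eta> = \<delta> (ev minpol)"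
    by (simp add: derivation_eval2[OF deriv_\<delta> \<delta>_c] \<delta>_\<xi>)
  also have "\<dots> = 0" by (simp add: minpol derivation_0[OF deriv_\<delta>])
  finally have 1: "ev (map_poly pderiv minpol) = - (ev (pderiv minpol) * \<delta> \<eta>)"
    by (simp add: eq_neg_iff_add_eq_0)
  have "ev P * ev (map_poly pderiv minpol) + ev Q * ev (pderiv minpol) = 0"
    using ev_tangent[OF minpol(2)] by (simp add: eval2_add eval2_mult)
  hence "ev (pderiv minpol) * (ev Q - ev P * \<delta> \<eta>) = 0" by (simp add: 1 algebra_simps)
  thus ?thesis using ev_pderiv_minpol by (metis mult_eq_0_iff right_minus_eq)
qed

lemma \<delta>_ev: "ev P * \<delta> (ev F) = ev (P * map_poly pderiv F + Q * pderiv F)"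
proof -
  have "ev P * \<delta> (ev F) = ev P * ev (map_poly pderiv F) + ev (pderiv F) * (ev P * \<delta> \<eta>)"
    by (simp add: derivation_eval2[OF deriv_\<delta> \<delta>_c] \<delta>_\<xi> algebra_simps)
  also have "\<dots> = ev P * ev (map_poly pderiv F) + ev (pderiv F) * ev Q" by (simp only: \<delta>_\<eta>)
  finally show ?thesis by (simp add: eval2_add eval2_mult mult.commute)
qed

lemma is_subfield_K: "is_subfield K"
  unfolding curve_field_def by (rule is_subfield_hull)

sublocale K: subfield K
  by unfold_locales (rule is_subfield_K)

lemma K_generators: "range c \<subseteq> K" "\<xi> \<in> K" "\<eta> \<in> K"
  using hull_subset[of "range c \<union> {\<xi>, \<eta>}" is_subfield] by (auto simp: curve_field_def)

lemma ev_in_K: "ev F \<in> K"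
  by (rule subfield_eval2[OF const_hom_axioms is_subfield_K K_generators])

lemma K_fraction:
  assumes "g \<in> K"
  obtains A B where "ev B \<noteq> 0" "g = ev A / ev B"
proof -
  let ?S = "{ev A / ev B | A B. ev B \<noteq> 0}"
  have "ev [:[:z:]:] = c z" "ev [:[:0, 1:]:] = \<xi>" "ev [:0, 1:] = \<eta>" for z
    by (simp_all add: eval2_c_pCons map_poly_c_pCons c_zero c_one one_pCons)
  hence "c z = ev [:[:z:]:] / ev 1" "\<xi> = ev [:[:0, 1:]:] / ev 1" "\<eta> = ev [:0, 1:] / ev 1" for z
    by simp_all
  moreover have 1: "ev 1 \<noteq> 0" by simp
  ultimately have gen: "range c \<union> {\<xi>, \<eta>} \<subseteq> ?S" by blast
  have "is_subfield ?S"
    unfolding is_subfield_def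
  proof (intro conjI ballI)
    have "0 = ev 0 / ev 1" "1 = ev 1 / ev 1" by simp_all
    thus "0 \<in> ?S" "1 \<in> ?S" using 1 by blast+
    fix a assume "a \<in> ?S"
    then obtain A B where a: "a = ev A / ev B" "ev B \<noteq> 0" by blast
    show "inverse a \<in> ?S"
    proof (cases "ev A = 0")
      case True
      thus ?thesis using \<open>0 \<in> ?S\<close> a by simp
    next
      case False
      moreover have "inverse a = ev B / ev A" using a by simp
      ultimately show ?thesis by blast
    qed
    fix b assume "b \<in> ?S"
    then obtain A' B' where b: "b = ev A' / ev B'" "ev B' \<noteq> 0" by blast
    have nz: "ev (B * B') \<noteq> 0" using a b by (simp add: eval2_mult)
    have "a + b = ev (A * B' + A' * B) / ev (B * B')" "a - b = ev (A * B' - A' * B) / ev (B * B')"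
      "a * b = ev (A * A') / ev (B * B')"
      unfolding a(1) b(1) using a(2) b(2)
      by (simp_all add: eval2_mult eval2_add eval2_diff field_simps)
    thus "a + b \<in> ?S" "a - b \<in> ?S" "a * b \<in> ?S" using nz by blast+
  qed
  hence "K \<subseteq> ?S" unfolding curve_field_def by (intro hull_minimal gen)
  thus ?thesis using assms that by blast
qed

lemma \<beta>_1: "\<beta> 1 = ev (pderiv Q * P - Q * pderiv P) / ev (P * P)"
  using ev_P P_nonzero
  by (simp add: beta_def ddy_def fract_deriv_Fract[OF derivation_pderiv] eval_ratfun_Fract eval2_mult)

lemma \<beta>_1_in_K: "\<beta> 1 \<in> K"
  unfolding \<beta>_1 by (intro K.divide_in ev_in_K)

end

section \<open>Irregularity excludes algebraic exponentials\<close>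

text \<open>
  Evaluation along a branch at infinity embeds \<open>K\<close>. The point is injectivity: a polynomial that vanishes along one
  branch vanishes on the whole curve, because the curve is irreducible.
\<close>

lemma (in realized_curve) branch_eval_eq_0_iff:
  assumes br: "branch_at_infinity U \<phi> e \<psi>"
  shows "eval2 fls_const F (fls_X_inv ^ e) \<psi> = 0 \<longleftrightarrow> ev F = 0"
proof
  let ?X = "fls_X_inv ^ e :: complex fls"
  let ?ev = "\<lambda>F. eval2 fls_const F ?X \<psi>"
  interpret s: const_hom "fls_const :: complex \<Rightarrow> complex fls" by (rule const_hom_fls_const)
  have sub: "?ev F = 0" if "ev F = 0" for F
    using br that by (simp add: branch_at_infinity_def ev_eq_0_iff)
  thus "ev F = 0 \<Longrightarrow> ?ev F = 0" by blast
  have dX: "fls_deriv ?X \<noteq> 0"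
  proof -
    have "e \<ge> 1" using br by (simp add: branch_at_infinity_def)
    hence "fls_deriv ?X $$ (- int e - 1) \<noteq> 0" by (simp add: fls_X_inv_power_conv_shift_1)
    thus ?thesis by (metis fls_zero_nth)
  qed
  have trans: "p = 0" if "?ev [:p:] = 0" for p
    using that eval1_eq_0_imp_eq_0[OF const_hom_fls_const derivation_fls_deriv _ dX, of p]
    by (simp add: s.eval2_const)
  assume F: "?ev F = 0"
  show "ev F = 0"
  proof (rule ccontr)
    assume nF: "ev F \<noteq> 0"
    \<comment> \<open>Pseudo-division by \<open>R\<close> shows that, up to factors from \<open>C[x]\<close>, everything vanishing along the branch is a
      multiple of \<open>R\<close>. Applied to \<open>minpol\<close>, this puts \<open>R\<close> into the ideal of the curve; applied to \<open>F\<close>, it then puts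
      \<open>F\<close> there.\<close>
    define R where "R = (ARG_MIN degree F. F \<noteq> 0 \<and> ?ev F = 0)"
    have "R \<noteq> 0 \<and> ?ev R = 0"
      unfolding R_def by (rule arg_min_natI[of _ F]) (use F nF in auto)
    hence R: "R \<noteq> 0" "?ev R = 0" by auto
    have R_le: "degree R \<le> degree G" if "G \<noteq> 0" "?ev G = 0" for G
      unfolding R_def by (rule arg_min_nat_le) (use that in auto)
    have degR: "degree R > 0"
      using R trans by (metis bot_nat_0.not_eq_extremum degree_eq_zeroE pCons_0_0)
    have lc: "ev [:lead_coeff R ^ n:] \<noteq> 0" for n
      using R by (simp add: eval2_const eval1_\<xi>_eq_0_iff)
    have div: "\<exists>q n. smult (lead_coeff R ^ n) G = R * q" if "?ev G = 0" for G
    proof -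
      obtain q r where qr: "pseudo_divmod G R = (q, r)" by force
      note pd = pseudo_divmod[OF R(1) qr]
      define n where "n = Suc (degree G) - degree R"
      have eq: "smult (lead_coeff R ^ n) G = R * q + r" using pd(1) by (simp add: n_def)
      have "?ev (smult (lead_coeff R ^ n) G) = 0" using that by (simp add: s.eval2_smult)
      hence "?ev r = 0" using R by (simp add: eq s.eval2_add s.eval2_mult)
      hence "r = 0" using pd(2) R_le[of r] by linarith
      thus ?thesis using eq by auto
    qed
    have "ev R = 0"
    proof (rule ccontr)
      assume nR: "ev R \<noteq> 0"
      obtain q n where q: "smult (lead_coeff R ^ n) minpol = R * q"
        using div[OF sub[OF minpol(2)]] by blast
      have "ev (R * q) = 0" unfolding q[symmetric] by (simp add: eval2_smult minpol)
      hence "ev q = 0" using nR by (simp add: eval2_mult)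
      moreover have "q \<noteq> 0"
        using q minpol R by auto
      moreover from this have "degree minpol = degree R + degree q"
        using q R by (metis degree_mult_eq degree_smult_eq leading_coeff_0_iff power_not_zero)
      ultimately show False using minpol_le[of q] degR by simp
    qed
    moreover obtain q n where q: "smult (lead_coeff R ^ n) F = R * q"
      using div[OF F] by blast
    ultimately have "ev (smult (lead_coeff R ^ n) F) = 0" by (simp add: eval2_mult)
    thus False using nF lc[of n] by (simp add: eval2_smult eval2_const)
  qed
qed

text \<open>
  A logarithmic derivative has at most a simple pole, so multiplication by \<open>s\<close> already makes \<open>b\<close> holomorphic.
\<close>

lemma logarithmic_derivative_regular:
  fixes g b :: "complex fls"
  assumes g: "g \<noteq> 0" and eq: "fls_deriv g = of_int n * b * g" and n: "n \<noteq> 0"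
  shows "\<not> irregular_singular_at_0 b"
proof -
  have "0 \<le> fls_subdegree (fls_X ^ 1 * b)"
  proof (cases "b = 0")
    case False
    have nz: "of_int n * b * g \<noteq> 0" using False g n by simp
    have "fls_subdegree (of_int n * b * g) = fls_subdegree b + fls_subdegree g"
      using False g n by (simp add: fls_subdegree_mult)
    moreover have "fls_subdegree g - 1 \<le> fls_subdegree (fls_deriv g)"
      proof (rule fls_subdegree_geI)
      show "fls_deriv g \<noteq> 0" using nz eq by simp
      show "fls_deriv g $$ k = 0" if "k < fls_subdegree g - 1" for k
        using that by (simp add: fls_eq0_below_subdegree)
    qed
    ultimately have "- 1 \<le> fls_subdegree b" using eq by simp
    thus ?thesis using False by (simp add: fls_subdegree_mult)
  qed simp
  hence "(LEAST h :: nat. 0 \<le> fls_subdegree (fls_X ^ h * b)) \<le> 1" by (rule Least_le)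
  thus ?thesis by (simp add: irregular_singular_at_0_def)
qed

locale irregular_curve = realized_curve +
  assumes irregular: "VE1_irregular_at_infinity (Fract Q P) U \<phi>"
begin

text \<open>
  A nonzero element \<open>g\<close> of \<open>K\<close> with \<open>g' = n \<beta>\<^sub>1 g\<close> would, read along the branch at infinity, make \<open>n \<beta>\<^sub>1\<close> a
  logarithmic derivative of a Laurent series, which has at most a simple pole.
\<close>

lemma no_exponential_in_K:
  assumes g: "g \<in> K" "\<delta> g = of_int n * \<beta> 1 * g" and n: "n \<noteq> 0"
  shows "g = 0"
proof (rule ccontr)
  assume g0: "g \<noteq> 0"
  obtain A B where AB: "ev B \<noteq> 0" "g = ev A / ev B" using K_fraction[OF g(1)] .
  have A: "ev A \<noteq> 0" using AB g0 by auto
  obtain e \<psi> where br: "branch_at_infinity U \<phi> e \<psi>"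
    and irr: "irregular_singular_at_0
          (fls_deriv (fls_X_inv ^ e) * eval_ratfun fls_const (ddy f) (fls_X_inv ^ e) \<psi>)"
    using irregular by (auto simp: VE1_irregular_at_infinity_def)
  let ?X = "fls_X_inv ^ e :: complex fls"
  let ?ev = "\<lambda>F. eval2 fls_const F ?X \<psi>"
  interpret s: const_hom "fls_const :: complex \<Rightarrow> complex fls" by (rule const_hom_fls_const)
  note iff = branch_eval_eq_0_iff[OF br]
  let ?D = "\<lambda>F. P * map_poly pderiv F + Q * pderiv F"
  let ?N = "pderiv Q * P - Q * pderiv P"

  \<comment> \<open>The relation for \<open>g\<close> with the denominators cleared.\<close>
  have "ev P * (\<delta> (ev A) * ev B - ev A * \<delta> (ev B)) * ev P = of_int n * ev ?N * ev A * ev B"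
  proof -
    have "(\<delta> (ev A) * ev B - ev A * \<delta> (ev B)) / (ev B * ev B) = of_int n * (ev ?N / (ev P * ev P)) * (ev A / ev B)"
      using g(2) unfolding AB(2) derivation_divide[OF deriv_\<delta> AB(1)] \<beta>_1 eval2_mult .
    moreover have "p * x * p = n' * N * a * b"
      if "x / (b * b) = n' * (N / (p * p)) * (a / b)" "b \<noteq> 0" "p \<noteq> 0" for x a b p N n' :: 'a
    proof -
      have "p * x * p = x / (b * b) * (b * b * p * p)" using that(2) by simp
      also have "\<dots> = n' * N * a * b" unfolding that(1) using that(2,3) by simp
      finally show ?thesis .
    qed
    ultimately show ?thesis using AB(1) ev_P by blast
  qed
  moreover have "ev P * (\<delta> (ev A) * ev B - ev A * \<delta> (ev B)) = ev (?D A) * ev B - ev A * ev (?D B)"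
    unfolding \<delta>_ev[symmetric] by (simp add: algebra_simps)
  ultimately have "ev ((?D A * B - A * ?D B) * P - of_int n * ?N * A * B) = 0"
    by (simp add: eval2_mult eval2_diff eval2_of_int)
  hence "?ev ((?D A * B - A * ?D B) * P - of_int n * ?N * A * B) = 0" by (simp add: iff)
  hence rel: "(?ev (?D A) * ?ev B - ?ev A * ?ev (?D B)) * ?ev P = of_int n * ?ev ?N * ?ev A * ?ev B"
    by (simp add: s.eval2_mult s.eval2_diff s.eval2_of_int)
  have nz: "?ev P \<noteq> 0" "?ev A \<noteq> 0" "?ev B \<noteq> 0" using iff ev_P A AB by auto

  \<comment> \<open>Along the branch, \<open>d/ds\<close> restricts to \<open>(dx/ds) \<delta>\<close>; as for \<open>\<delta>_\<eta>\<close>, this is read off from the minimal relation.\<close>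
  have chain: "fls_deriv (?ev F) = ?ev (map_poly pderiv F) * fls_deriv ?X + ?ev (pderiv F) * fls_deriv \<psi>" for F
    by (rule s.derivation_eval2[OF derivation_fls_deriv]) simp
  have "fls_deriv \<psi> * ?ev P = fls_deriv ?X * ?ev Q"
  proof -
    have "?ev (?D minpol) = 0" "?ev minpol = 0" using ev_tangent[OF minpol(2)] minpol iff by auto
    hence 1: "?ev P * ?ev (map_poly pderiv minpol) + ?ev Q * ?ev (pderiv minpol) = 0"
      and 2: "?ev (map_poly pderiv minpol) * fls_deriv ?X + ?ev (pderiv minpol) * fls_deriv \<psi> = 0"
      using chain[of minpol] by (simp_all add: s.eval2_add s.eval2_mult)
    have "?ev (pderiv minpol) * (fls_deriv \<psi> * ?ev P - fls_deriv ?X * ?ev Q)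
        = ?ev P * (?ev (map_poly pderiv minpol) * fls_deriv ?X + ?ev (pderiv minpol) * fls_deriv \<psi>)
          - fls_deriv ?X * (?ev P * ?ev (map_poly pderiv minpol) + ?ev Q * ?ev (pderiv minpol))"
      by (simp add: algebra_simps)
    thus ?thesis using 1 2 ev_pderiv_minpol iff by simp
  qed
  hence D: "fls_deriv (?ev F) * ?ev P = fls_deriv ?X * ?ev (?D F)" for F
    unfolding chain by (simp add: s.eval2_add s.eval2_mult algebra_simps)

  let ?b = "fls_deriv ?X * eval_ratfun fls_const (ddy f) ?X \<psi>"
  have b: "?b = fls_deriv ?X * ?ev ?N / (?ev P * ?ev P)"
    using nz P_nonzero
    by (simp add: ddy_def fract_deriv_Fract[OF derivation_pderiv] s.eval_ratfun_Fract s.eval2_mult)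
  have "fls_deriv (?ev A / ?ev B) = of_int n * ?b * (?ev A / ?ev B)"
  proof -
    have "(fls_deriv (?ev A) * ?ev B - ?ev A * fls_deriv (?ev B)) * (?ev P * ?ev P)
        = (fls_deriv (?ev A) * ?ev P * ?ev B - ?ev A * (fls_deriv (?ev B) * ?ev P)) * ?ev P"
      by (simp add: algebra_simps)
    also have "\<dots> = fls_deriv ?X * ((?ev (?D A) * ?ev B - ?ev A * ?ev (?D B)) * ?ev P)"
      unfolding D by (simp add: algebra_simps)
    also have "\<dots> = fls_deriv ?X * (of_int n * ?ev ?N * ?ev A * ?ev B)" unfolding rel ..
    finally show ?thesis
      unfolding b derivation_divide[OF derivation_fls_deriv nz(3)] using nz by (simp add: field_simps)
  qed
  from logarithmic_derivative_regular[OF _ this n] nz irr show False by simp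
qed

end

section \<open>Taylor expansion transversal to the curve\<close>

definition fps_coeff_deriv :: "('a::comm_ring_1 \<Rightarrow> 'a) \<Rightarrow> 'a fps \<Rightarrow> 'a fps" where
  "fps_coeff_deriv \<delta> F = Abs_fps (\<lambda>n. \<delta> (fps_nth F n))"

lemma fps_coeff_deriv_nth [simp]: "fps_nth (fps_coeff_deriv \<delta> F) n = \<delta> (fps_nth F n)"
  by (simp add: fps_coeff_deriv_def)

lemma fls_coeff_deriv_fps_to_fls:
  "derivation \<delta> \<Longrightarrow> fls_coeff_deriv \<delta> (fps_to_fls F) = fps_to_fls (fps_coeff_deriv \<delta> F)"
  by (rule fls_eqI) (simp add: fls_coeff_deriv_nth derivation_0)

lemma fls_times_nth_lowest:
  fixes f g :: "'a::idom fls"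
  assumes f: "\<And>i. i < l \<Longrightarrow> f $$ i = 0" and g: "\<And>i. i < m \<Longrightarrow> g $$ i = 0"
  shows "(f * g) $$ (l + m) = f $$ l * g $$ m"
proof (cases "f = 0 \<or> g = 0")
  case False
  hence "l \<le> fls_subdegree f" "m \<le> fls_subdegree g"
    using f g by (simp_all add: fls_subdegree_geI)
  thus ?thesis by (simp add: fls_times_nth_wide)
qed auto

lemma dvd_pderiv_imp_eq_0:
  fixes p :: "'a::{idom, semiring_char_0} poly"
  assumes "p dvd pderiv p"
  shows "pderiv p = 0"
proof (rule ccontr)
  assume "pderiv p \<noteq> 0"
  with assms have "degree p \<le> degree (pderiv p)" "degree p \<noteq> 0"
    by (auto simp: dvd_imp_degree_le pderiv_eq_0_iff)
  thus False by (simp add: degree_pderiv)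
qed

text \<open>
  In a reduced fraction with vanishing derivative, the denominator divides its own derivative; comparing degrees in \<open>y\<close>
  and then in \<open>x\<close> leaves only constants.
\<close>

lemma ratfun_constant:
  assumes "ddx H = 0" "ddy H = 0"
  shows "\<exists>z. H = Fract [:[:z:]:] 1"
proof -
  define A B where AB: "A = fst (quot_of_fract H)" "B = snd (quot_of_fract H)"
  have H: "H = Fract A B" by (simp add: AB)
  have B0: "B \<noteq> 0" by (simp add: AB)
  have cop: "coprime B A" by (simp add: AB coprime_quot_of_fract coprime_commute)
  have dvd: "B dvd d B \<and> (d B = 0 \<longrightarrow> d A = 0)" if d: "derivation d" "fract_deriv d H = 0" for d
  proof -
    have "Fract (d A * B - A * d B) (B * B) = 0"
      using d fract_deriv_Fract[OF d(1) B0] by (simp add: H)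
    hence eq: "d A * B = A * d B" using B0 by (simp add: Zero_fract_def eq_fract)
    hence "B dvd A * d B" by (metis dvd_triv_right)
    thus ?thesis using cop eq B0 by (auto simp: coprime_dvd_mult_right_iff)
  qed
  have y: "B dvd pderiv B" "pderiv B = 0 \<longrightarrow> pderiv A = 0"
    using dvd[OF derivation_pderiv] assms by (auto simp: ddy_def)
  have "pderiv B = 0" by (rule dvd_pderiv_imp_eq_0[OF y(1)])
  with y obtain a b where ab: "A = [:a:]" "B = [:b:]"
    by (metis degree_eq_zeroE pderiv_eq_0_iff)
  have x: "b dvd pderiv b" "pderiv b = 0 \<longrightarrow> pderiv a = 0"
    using dvd[OF derivation_map_poly[OF derivation_pderiv]] assms
    by (auto simp: ddx_def ab map_poly_pCons)
  have "pderiv b = 0" by (rule dvd_pderiv_imp_eq_0[OF x(1)])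
  with x obtain u v where uv: "a = [:u:]" "b = [:v:]"
    by (metis degree_eq_zeroE pderiv_eq_0_iff)
  have "v \<noteq> 0" using B0 by (simp add: ab uv)
  hence "H = Fract [:[:u / v:]:] 1" by (simp add: H ab uv eq_fract)
  thus ?thesis ..
qed

context realized_curve
begin

abbreviation "cu \<equiv> \<lambda>z. fls_const (c z)"

sublocale u: const_hom cu
  by (rule const_hom_fls_const_comp) (rule const_hom_axioms)

abbreviation "evu F \<equiv> eval2 cu F (fls_const \<xi>) (fls_const \<eta> + fls_X)"

definition taylor :: "ratfun \<Rightarrow> 'a fls" where
  "taylor H = eval_ratfun cu H (fls_const \<xi>) (fls_const \<eta> + fls_X)"

lemma fls_deriv_evu: "fls_deriv (evu F) = evu (pderiv F)"
  by (subst u.derivation_eval2[OF derivation_fls_deriv]) simp_all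

text \<open>
  The expansion at the curve is injective, so every rational function can be expanded, also one with poles along the
  curve: differentiation in \<open>u\<close> removes \<open>y\<close>, and the transcendence of \<open>\<xi>\<close> does the rest.
\<close>

lemma evu_eq_0_iff: "evu F = 0 \<longleftrightarrow> F = 0"
proof
  show "F = 0" if "evu F = 0"
    using that
  proof (induction "degree F" arbitrary: F rule: less_induct)
    case (less F)
    have "evu (pderiv F) = 0" using less.prems by (simp flip: fls_deriv_evu)
    hence "degree F = 0"
      using less.hyps[of "pderiv F"] by (cases "degree F = 0") (auto simp: degree_pderiv pderiv_eq_0_iff)
    then obtain p where p: "F = [:p:]" by (rule degree_eq_zeroE)
    have "poly (map_poly cu p) (fls_const \<xi>) = 0"
      using less.prems by (simp add: p u.eval2_const)
    moreover have "fls_coeff_deriv \<delta> (fls_const \<xi>) \<noteq> 0"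
      by (simp add: fls_coeff_deriv_const deriv_\<delta> \<delta>_\<xi>)
    ultimately have "p = 0"
      by (intro eval1_eq_0_imp_eq_0[OF u.const_hom_axioms derivation_fls_coeff_deriv[OF deriv_\<delta>]])
         (simp_all add: fls_coeff_deriv_const deriv_\<delta> \<delta>_c)
    thus ?case by (simp add: p)
  qed
qed simp

lemma evu_fps: "\<exists>F'. evu F = fps_to_fls F' \<and> fps_nth F' 0 = ev F"
proof (induction F)
  case 0
  show ?case by (intro exI[of _ 0]) simp
next
  case (pCons p F)
  then obtain F' where F': "evu F = fps_to_fls F'" "fps_nth F' 0 = ev F" by blast
  have p: "poly (map_poly cu p) (fls_const \<xi>) = fls_const (poly (map_poly c p) \<xi>)"
    by (induction p) (simp_all add: map_poly_c_pCons u.map_poly_c_pCons fls_plus_const)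
  show ?case
    by (intro exI[of _ "fps_const (poly (map_poly c p) \<xi>) + (fps_const \<eta> + fps_X) * F'"])
       (simp add: u.eval2_c_pCons eval2_c_pCons p F' fls_times_fps_to_fls)
qed

lemma taylor_Fract: "B \<noteq> 0 \<Longrightarrow> taylor (Fract A B) = evu A / evu B"
  unfolding taylor_def by (rule u.eval_ratfun_Fract) (simp add: evu_eq_0_iff)

lemma taylor_add: "taylor (H + H') = taylor H + taylor H'"
proof -
  obtain A B A' B' where "H = Fract A B" "B \<noteq> 0" "H' = Fract A' B'" "B' \<noteq> 0"
    by (metis Fract_quot_of_fract snd_quot_of_fract_nonzero)
  moreover from this have "evu B \<noteq> 0" "evu B' \<noteq> 0" by (simp_all add: evu_eq_0_iff)
  from add_frac_eq[OF this, of "evu A" "evu A'"]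
  have "evu A / evu B + evu A' / evu B' = (evu A * evu B' + evu A' * evu B) / (evu B * evu B')" .
  ultimately show ?thesis by (simp add: taylor_Fract u.eval2_add u.eval2_mult)
qed

lemma taylor_mult: "taylor (H * H') = taylor H * taylor H'"
proof -
  obtain A B A' B' where "H = Fract A B" "B \<noteq> 0" "H' = Fract A' B'" "B' \<noteq> 0"
    by (metis Fract_quot_of_fract snd_quot_of_fract_nonzero)
  thus ?thesis by (simp add: taylor_Fract u.eval2_mult)
qed

lemma taylor_eq_0_iff: "taylor H = 0 \<longleftrightarrow> H = 0"
proof -
  obtain A B where H: "H = Fract A B" "B \<noteq> 0"
    by (metis Fract_quot_of_fract snd_quot_of_fract_nonzero)
  thus ?thesis by (simp add: taylor_Fract evu_eq_0_iff Zero_fract_def eq_fract)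
qed

lemma taylor_0 [simp]: "taylor 0 = 0"
  by (simp add: taylor_eq_0_iff)

lemma taylor_diff: "taylor (H - H') = taylor H - taylor H'"
  using taylor_add[of "H - H'" H'] by simp

lemma taylor_in_K: "taylor H $$ n \<in> K"
proof -
  have "taylor H \<in> {F. \<forall>n. F $$ n \<in> K}"
    unfolding taylor_def
  proof (rule subfield_eval_ratfun[OF u.const_hom_axioms K.is_subfield_fls])
    show "range cu \<subseteq> {F. \<forall>n. F $$ n \<in> K}"
      "fls_const \<xi> \<in> {F. \<forall>n. F $$ n \<in> K}" "fls_const \<eta> + fls_X \<in> {F. \<forall>n. F $$ n \<in> K}"
      using K_generators by (auto simp: fls_const_nth fls_X_nth)
  qed
  thus ?thesis by blast
qed

lemma taylor_ddy: "taylor (ddy H) = fls_deriv (taylor H)"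
proof -
  obtain A B where H: "H = Fract A B" "B \<noteq> 0"
    by (metis Fract_quot_of_fract snd_quot_of_fract_nonzero)
  hence "evu B \<noteq> 0" by (simp add: evu_eq_0_iff)
  thus ?thesis
    by (simp add: H ddy_def fract_deriv_Fract[OF derivation_pderiv] taylor_Fract fls_deriv_evu
          derivation_divide[OF derivation_fls_deriv] u.eval2_mult u.eval2_diff)
qed

text \<open>
  The transversal part of \<open>f\<close>: in the coordinate \<open>u = y - \<eta>\<close> the foliation is the vector field
  \<open>\<delta> + w \<partial>\<^sub>u\<close>.
\<close>

definition transversal :: "'a fps" where
  "transversal = Abs_fps (\<lambda>n. if n = 0 then 0 else \<beta> n / fact n)"

lemma eval_ratfun_f: "eval_ratfun c f \<xi> \<eta> = \<delta> \<eta>"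
  using \<delta>_\<eta> ev_P by (simp add: eval_ratfun_Fract field_simps)

text \<open>
  The functions whose values define the \<open>\<beta>\<^sub>j\<close> have no pole along the curve, so these values are constant terms of
  expansions.
\<close>

lemma taylor_regular:
  assumes "ev B \<noteq> 0"
  shows "\<exists>F. taylor (Fract A B) = fps_to_fls F \<and> fps_nth F 0 = eval_ratfun c (Fract A B) \<xi> \<eta>"
proof -
  obtain A' where A': "evu A = fps_to_fls A'" "fps_nth A' 0 = ev A" using evu_fps by blast
  obtain B' where B': "evu B = fps_to_fls B'" "fps_nth B' 0 = ev B" using evu_fps by blast
  have B0: "B \<noteq> 0" using assms by auto
  have "fps_to_fls B' * fps_to_fls (inverse B') = 1"
    using inverse_mult_eq_1'[of B'] assms B'
    by (simp flip: fls_times_fps_to_fls)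
  hence "taylor (Fract A B) = fps_to_fls (A' * inverse B')"
    using B0 by (simp add: taylor_Fract A' B' fls_times_fps_to_fls evu_eq_0_iff divide_inverse
        inverse_unique)
  thus ?thesis using A' B' assms by (auto simp: eval_ratfun_Fract divide_inverse)
qed

lemma ddy_regular:
  "\<exists>A B. (ddy ^^ j) f = Fract A B \<and> ev B \<noteq> 0"
proof (induction j)
  case 0
  show ?case using ev_P by auto
next
  case (Suc j)
  then obtain A B where AB: "(ddy ^^ j) f = Fract A B" "ev B \<noteq> 0" by auto
  hence B0: "B \<noteq> 0" by auto
  have "(ddy ^^ Suc j) f = ddy (Fract A B)"
    by (simp add: AB)
  also have "\<dots> = Fract (pderiv A * B - A * pderiv B) (B * B)"
    by (simp add: ddy_def fract_deriv_Fract[OF derivation_pderiv B0])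
  finally have "(ddy ^^ Suc j) f = Fract (pderiv A * B - A * pderiv B) (B * B)" .
  moreover have "ev (B * B) \<noteq> 0" using AB by (simp add: eval2_mult)
  ultimately show ?case by blast
qed

text \<open>
  Taylor's formula: \<open>\<partial>/\<partial>y\<close> becomes \<open>d/du\<close>, so the \<open>\<beta>\<^sub>j\<close> are the higher derivatives at \<open>u = 0\<close>. The constant term is
  \<open>\<delta> \<eta>\<close> because the curve is invariant.
\<close>

lemma taylor_f: "taylor f = fls_const (\<delta> \<eta>) + fps_to_fls transversal"
proof -
  obtain F where F: "taylor f = fps_to_fls F" using taylor_regular[OF ev_P] by blast
  have j: "fact j * fps_nth F j = \<beta> j" for j
  proof -
    obtain A B where AB: "(ddy ^^ j) f = Fract A B" "ev B \<noteq> 0" using ddy_regular by blast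
    have pow: "taylor ((ddy ^^ j) f) = fps_to_fls ((fps_deriv ^^ j) F)"
      by (induction j) (simp_all add: F taylor_ddy fls_deriv_fps_to_fls)
    have "\<beta> j = fps_nth ((fps_deriv ^^ j) F) 0"
      using taylor_regular[OF AB(2), of A] pow by (auto simp: beta_def AB)
    also have "\<dots> = fact j * fps_nth F j" by (simp add: fps_0th_higher_deriv)
    finally show ?thesis ..
  qed
  have "F = fps_const (\<delta> \<eta>) + transversal"
  proof (rule fps_ext)
    fix n
    have "fps_nth F n = \<beta> n / fact n" using j[of n] by (simp add: nonzero_eq_divide_eq mult.commute)
    thus "fps_nth F n = fps_nth (fps_const (\<delta> \<eta>) + transversal) n"
      using eval_ratfun_f by (simp add: transversal_def beta_def)
  qed
  thus ?thesis by (simp add: F)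
qed

abbreviation "D \<equiv> fls_vf \<delta> (fps_to_fls transversal)"

text \<open>
  Expansion intertwines \<open>\<partial>\<^sub>x + f \<partial>\<^sub>y\<close> with \<open>D\<close>: both send \<open>\<xi>\<close> to \<open>1\<close> and \<open>\<eta> + u\<close> to \<open>f\<close>, and the chain rule
  determines the rest.
\<close>

lemma D_taylor: "D (taylor H) = taylor (ddx H) + taylor f * taylor (ddy H)"
proof -
  obtain A B where H: "H = Fract A B" "B \<noteq> 0"
    by (metis Fract_quot_of_fract snd_quot_of_fract_nonzero)
  note der = derivation_fls_vf[OF deriv_\<delta>, of "fps_to_fls transversal"]
  have B: "evu B \<noteq> 0" using H by (simp add: evu_eq_0_iff)
  have D_evu: "D (evu F) = evu (map_poly pderiv F) + taylor f * evu (pderiv F)" for F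
    by (subst u.derivation_eval2[OF der])
       (simp_all add: fls_vf_const fls_vf_X derivation_add[OF der] deriv_\<delta> \<delta>_c \<delta>_\<xi> taylor_f)
  have x: "taylor (ddx H) = (evu (map_poly pderiv A) * evu B - evu A * evu (map_poly pderiv B)) / (evu B * evu B)"
    using H by (simp add: ddx_def fract_deriv_Fract[OF derivation_map_poly[OF derivation_pderiv]]
        taylor_Fract u.eval2_mult u.eval2_diff)
  have y: "taylor (ddy H) = (evu (pderiv A) * evu B - evu A * evu (pderiv B)) / (evu B * evu B)"
    using H by (simp add: ddy_def fract_deriv_Fract[OF derivation_pderiv]
        taylor_Fract u.eval2_mult u.eval2_diff)
  have "D (taylor H) = (D (evu A) * evu B - evu A * D (evu B)) / (evu B * evu B)"
    using H by (simp add: taylor_Fract derivation_divide[OF der B])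
  also have "\<dots> = taylor (ddx H) + taylor f * taylor (ddy H)"
    unfolding D_evu x y by (simp add: add_divide_distrib[symmetric] algebra_simps)
  finally show ?thesis .
qed

lemma Q_eq: "Fract Q 1 = f * Fract P 1"
  using P_nonzero by (simp add: eq_fract)

lemma taylor_Q: "taylor (Fract Q 1) = taylor f * taylor (Fract P 1)"
  by (simp only: Q_eq taylor_mult)

lemma taylor_vf_apply:
  "taylor (vf_apply (Fract P 1, Fract Q 1) H) = taylor (Fract P 1) * D (taylor H)"
  by (simp add: vf_apply_def taylor_add taylor_mult taylor_Q D_taylor algebra_simps)

end

section \<open>Rational integrability gives an infinitesimal symmetry\<close>

context irregular_curve
begin

text \<open>
  Comparing lowest coefficients in \<open>D F = m w' F\<close> gives \<open>\<delta> a = (m - N) \<beta>\<^sub>1 a\<close> for the lowest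
  coefficient \<open>a u\<^sup>N\<close> of \<open>F\<close>; irregularity forces \<open>N = m\<close>.
\<close>

lemma lowest_term:
  assumes F: "F \<noteq> 0" "\<And>n. F $$ n \<in> K"
    and eq: "D F = of_int m * fls_deriv (fps_to_fls transversal) * F"
  shows "fls_subdegree F = m" "\<delta> (F $$ m) = 0"
proof -
  define N where "N = fls_subdegree F"
  have low: "F $$ i = 0" if "i < N" for i using that by (simp add: N_def fls_eq0_below_subdegree)
  let ?w = "fps_to_fls transversal"
  have w: "?w $$ i = 0" if "i < 1" for i
    using that by (auto simp: transversal_def)
  have w1: "?w $$ 1 = \<beta> 1" by (simp add: transversal_def)
  have "(?w * fls_deriv F) $$ (1 + (N - 1)) = ?w $$ 1 * fls_deriv F $$ (N - 1)"
    using w low by (intro fls_times_nth_lowest) simp_all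
  hence "D F $$ N = \<delta> (F $$ N) + of_int N * \<beta> 1 * F $$ N"
    using w1 by (simp add: fls_vf_def fls_coeff_deriv_nth deriv_\<delta> algebra_simps)
  moreover have "(fls_deriv ?w * F) $$ (0 + N) = fls_deriv ?w $$ 0 * F $$ N"
    using w low by (intro fls_times_nth_lowest) simp_all
  hence "(of_int m * fls_deriv ?w * F) $$ N = of_int m * \<beta> 1 * F $$ N"
    using w1 by (simp add: mult.assoc fls_of_int)
  ultimately have \<delta>: "\<delta> (F $$ N) = of_int (m - N) * \<beta> 1 * F $$ N"
    using eq by (simp add: algebra_simps)
  have "F $$ N \<noteq> 0" using F by (simp add: N_def)
  hence "m - N = 0" using no_exponential_in_K[OF F(2) \<delta>] by blast
  thus "fls_subdegree F = m" "\<delta> (F $$ m) = 0" using \<delta> by (simp_all add: N_def)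
qed

text \<open>
  The lowest exponent of a first integral is 0 and its constant term is a constant of \<open>\<delta>\<close>. Subtracting this term leaves a
  first integral of positive order, which has to vanish.
\<close>

lemma no_rational_first_integral:
  assumes H: "vf_apply (Fract P 1, Fract Q 1) H = 0"
  shows "\<exists>z. H = Fract [:[:z:]:] 1"
proof -
  note der = derivation_fls_vf[OF deriv_\<delta>, of "fps_to_fls transversal"]
  have "taylor (Fract P 1) \<noteq> 0"
    using P_nonzero by (simp add: taylor_eq_0_iff Zero_fract_def eq_fract)
  hence D: "D (taylor H) = 0"
    using taylor_vf_apply[of H] H by (simp add: taylor_eq_0_iff)
  define a where "a = taylor H $$ 0"
  have \<delta>a: "\<delta> a = 0"
  proof (cases "taylor H = 0")
    case False
    from lowest_term(2)[of "taylor H" 0, OF False taylor_in_K] D show ?thesis by (simp add: a_def)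
  qed (simp add: a_def derivation_0[OF deriv_\<delta>])
  have "taylor H - fls_const a = 0"
  proof (rule ccontr)
    assume nz: "taylor H - fls_const a \<noteq> 0"
    have "D (taylor H - fls_const a) = 0"
      using D \<delta>a by (simp add: derivation_diff[OF der] fls_vf_const deriv_\<delta>)
    moreover have "(taylor H - fls_const a) $$ n \<in> K" for n
      using taylor_in_K by (auto simp: a_def fls_const_nth)
    ultimately have "fls_subdegree (taylor H - fls_const a) = 0"
      by (intro lowest_term(1)[OF nz]) simp_all
    moreover have "(taylor H - fls_const a) $$ 0 = 0" by (simp add: a_def)
    ultimately show False using nz by (metis nth_fls_subdegree_zero_iff)
  qed
  hence "taylor H = fls_const a" by simp
  hence "taylor (ddy H) = 0" "taylor (ddx H) = 0"
    using D D_taylor[of H] by (simp_all add: taylor_ddy)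
  thus ?thesis by (intro ratfun_constant) (simp_all add: taylor_eq_0_iff)
qed

text \<open>
  Subtracting \<open>(A / P) X\<close> from \<open>Y = (A, B)\<close> makes it vertical, with component \<open>G = B - f A\<close>. The bracket of \<open>X / P\<close> with
  \<open>G \<partial>\<^sub>y\<close> is both vertical and a multiple of \<open>X\<close>, hence zero.
\<close>

lemma commuting_field_symmetry:
  assumes ind: "vf_independent (Fract P 1, Fract Q 1) Y"
    and comm: "lie_bracket (Fract P 1, Fract Q 1) Y = (0, 0)"
  shows "\<exists>G. G \<noteq> 0 \<and> (\<forall>n. G $$ n \<in> K) \<and> D G = fls_deriv (fps_to_fls transversal) * G"
proof -
  obtain A B where Y: "Y = (A, B)" by force
  define p a b \<phi> where "p = taylor (Fract P 1)" and "a = taylor A" and "b = taylor B" and "\<phi> = taylor f"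
  define G where "G = b - \<phi> * a"
  note der = derivation_fls_vf[OF deriv_\<delta>, of "fps_to_fls transversal"]
  have p: "p \<noteq> 0"
    using P_nonzero by (simp add: p_def taylor_eq_0_iff Zero_fract_def eq_fract)
  have q: "taylor (Fract Q 1) = \<phi> * p" by (simp add: taylor_Q \<phi>_def p_def)
  let ?dx = "\<lambda>F. D F - \<phi> * fls_deriv F"
  have dx: "taylor (ddx H) = ?dx (taylor H)" for H
    by (simp add: D_taylor taylor_ddy \<phi>_def)
  have 1: "p * D a = a * ?dx p + b * fls_deriv p"
  proof -
    have "vf_apply (Fract P 1, Fract Q 1) A = vf_apply (A, B) (Fract P 1)"
      using comm by (simp add: lie_bracket_def Y)
    hence "taylor (vf_apply (Fract P 1, Fract Q 1) A) = taylor (vf_apply (A, B) (Fract P 1))" by simp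
    thus ?thesis unfolding taylor_vf_apply
      by (simp add: vf_apply_def taylor_add taylor_mult dx taylor_ddy p_def a_def b_def)
  qed
  have 2: "p * D b = a * ?dx (\<phi> * p) + b * fls_deriv (\<phi> * p)"
  proof -
    have "vf_apply (Fract P 1, Fract Q 1) B = vf_apply (A, B) (Fract Q 1)"
      using comm by (simp add: lie_bracket_def Y)
    hence "taylor (vf_apply (Fract P 1, Fract Q 1) B) = taylor (vf_apply (A, B) (Fract Q 1))" by simp
    thus ?thesis unfolding taylor_vf_apply
      by (simp add: vf_apply_def taylor_add taylor_mult dx taylor_ddy q p_def[symmetric] a_def b_def)
  qed
  have "p * D G = p * D b - p * a * D \<phi> - \<phi> * (p * D a)"
    by (simp add: G_def derivation_diff[OF der] derivation_mult[OF der] algebra_simps)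
  also have "\<dots> = p * (fls_deriv \<phi> * G)"
    unfolding 1 2 by (simp add: G_def derivation_mult[OF der] algebra_simps)
  finally have "D G = fls_deriv \<phi> * G" using p by simp
  moreover have "fls_deriv \<phi> = fls_deriv (fps_to_fls transversal)"
    by (simp add: \<phi>_def taylor_f)
  moreover have "G \<noteq> 0"
  proof
    assume "G = 0"
    hence "taylor (Fract P 1 * B - Fract Q 1 * A) = 0"
      by (simp add: taylor_diff taylor_mult q p_def[symmetric] a_def[symmetric] b_def[symmetric] G_def)
    hence "- A * Fract P 1 + Fract P 1 * A = 0 \<and> - A * Fract Q 1 + Fract P 1 * B = 0"
      unfolding taylor_eq_0_iff by (simp add: algebra_simps)
    moreover have "Fract P 1 \<noteq> 0"
      using P_nonzero by (simp add: Zero_fract_def eq_fract)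
    ultimately show False
      using ind[unfolded vf_independent_def Y fst_conv snd_conv, rule_format, of "- A" "Fract P 1"] by blast
  qed
  moreover have "G = taylor (B - f * A)"
    by (simp add: G_def taylor_diff taylor_mult a_def b_def \<phi>_def)
  hence "G $$ n \<in> K" for n using taylor_in_K by simp
  ultimately show ?thesis by auto
qed

text \<open>
  Irregularity makes \<open>u\<close> the lowest power in \<open>G\<close>, with a coefficient that is a constant of \<open>\<delta>\<close>, so it can be scaled
  to 1 without affecting the equation.
\<close>

lemma infinitesimal_symmetry:
  assumes "rationally_integrable (Fract P 1, Fract Q 1)"
  shows "\<exists>G :: 'a fps. fps_nth G 0 = 0 \<and> fps_nth G 1 = 1 \<and> (\<forall>n. fps_nth G n \<in> K) \<and>
           fps_coeff_deriv \<delta> G + transversal * fps_deriv G = fps_deriv transversal * G"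
proof -
  note der = derivation_fls_vf[OF deriv_\<delta>, of "fps_to_fls transversal"]
  obtain Y where "vf_independent (Fract P 1, Fract Q 1) Y" "lie_bracket (Fract P 1, Fract Q 1) Y = (0, 0)"
    using assms no_rational_first_integral unfolding rationally_integrable_def by blast
  from commuting_field_symmetry[OF this] obtain G where
    G: "G \<noteq> 0" "\<And>n. G $$ n \<in> K" "D G = fls_deriv (fps_to_fls transversal) * G" by blast
  have sub: "fls_subdegree G = 1" and \<delta>a: "\<delta> (G $$ 1) = 0"
    using lowest_term[of G 1] G by simp_all
  define g where "g = fls_regpart G"
  have Gg: "G = fps_to_fls g" using sub by (simp add: g_def fls_regpart_to_fls_trivial)
  define a where "a = G $$ 1"
  have a: "a \<noteq> 0" using G(1) sub by (metis a_def nth_fls_subdegree_nonzero)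
  have aK: "a \<in> K" using G(2) by (simp add: a_def)
  have g: "fps_nth g 0 = 0" "fps_nth g 1 = a" "fps_nth g n \<in> K" for n
    using sub G(2) by (simp_all add: g_def a_def fls_eq0_below_subdegree)
  have "fps_to_fls (fps_coeff_deriv \<delta> g + transversal * fps_deriv g)
      = fps_to_fls (fps_deriv transversal * g)"
    using G(3) by (simp add: Gg fls_vf_def fls_coeff_deriv_fps_to_fls deriv_\<delta> fls_times_fps_to_fls
        fls_deriv_fps_to_fls)
  hence eq: "fps_coeff_deriv \<delta> g + transversal * fps_deriv g = fps_deriv transversal * g"
    by (rule fps_to_fls_eq_imp_fps_eq)
  have "fps_coeff_deriv \<delta> (fps_const (inverse a) * g) = fps_const (inverse a) * fps_coeff_deriv \<delta> g"
  proof (rule fps_ext)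
    fix n
    have "\<delta> (fps_nth g n / a) = \<delta> (fps_nth g n) / a"
      using \<delta>a a by (simp add: derivation_divide[OF deriv_\<delta> a] a_def[symmetric])
    thus "fps_nth (fps_coeff_deriv \<delta> (fps_const (inverse a) * g)) n
        = fps_nth (fps_const (inverse a) * fps_coeff_deriv \<delta> g) n"
      by (simp add: divide_inverse mult.commute)
  qed
  hence "fps_coeff_deriv \<delta> (fps_const (inverse a) * g)
          + transversal * fps_deriv (fps_const (inverse a) * g)
        = fps_const (inverse a) * (fps_coeff_deriv \<delta> g + transversal * fps_deriv g)"
    by (simp add: algebra_simps)
  also have "\<dots> = fps_deriv transversal * (fps_const (inverse a) * g)"
    unfolding eq by (simp add: algebra_simps)
  finally show ?thesis
    using g a aK by (intro exI[of _ "fps_const (inverse a) * g"]) auto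
qed

end

section \<open>Linearising the foliation along the curve\<close>

lemma wf_recursion_exists:
  assumes "wf R" and "\<And>f g x. (\<And>z. (z, x) \<in> R \<Longrightarrow> f z = g z) \<Longrightarrow> \<Phi> f x = \<Phi> g x"
  shows "\<exists>f. \<forall>x. f x = \<Phi> f x"
proof -
  have "adm_wf R \<Phi>" using assms(2) unfolding adm_wf_def by blast
  from wfrec_fixpoint[OF assms(1) this] show ?thesis by metis
qed

text \<open>
  All partitions of \<open>n\<close> except the trivial one have smaller parts; this is what makes the recursion below well-founded.
\<close>

lemma monomials_part_less:
  assumes "p \<in> monomials n" "p \<noteq> {#n#}" "i \<in># p"
  shows "i < n"
proof -
  obtain q where q: "p = add_mset i q" using multi_member_split[OF assms(3)] by blast
  have "0 \<notin># q" "i + sum_mset q = n" using assms(1) by (auto simp: q monomials_def)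
  moreover have "q \<noteq> {#}" using assms(2) calculation q by auto
  then obtain j q' where "q = add_mset j q'" by (metis multiset_cases)
  ultimately show ?thesis by auto
qed

lemma singleton_in_monomials: "n \<noteq> 0 \<Longrightarrow> {#n#} \<in> monomials n"
  by (simp add: monomials_def)

lemma VE_coeff_singleton [simp]: "VE_coeff {#n#} = 1"
  by (simp add: VE_coeff_def)

lemma (in subfield) VE_coeff_in: "VE_coeff p \<in> K"
  unfolding VE_coeff_def by (intro divide_in prod_in mult_in power_in fact_in)

lemma (in subfield) monomial_value_in: "(\<And>i. i \<in># m \<Longrightarrow> y i \<in> K) \<Longrightarrow> monomial_value y m \<in> K"
  unfolding monomial_value_def by (induction m) auto

text \<open>
  The series \<open>\<psi>\<close> carries \<open>v \<partial>\<^sub>v\<close> to \<open>G \<partial>\<^sub>u\<close>. Comparing coefficients of \<open>v\<^sup>n\<close> expresses \<open>(n - 1)\<close> times the coefficient \<open>n\<close>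
  of \<open>\<psi>\<close> by the earlier ones. For \<open>n \<ge> 2\<close> this is a recursion inside the subfield; for \<open>n = 1\<close> it is the condition
  \<open>G = u + \<dots>\<close> and leaves the coefficient free, to be chosen as 1.
\<close>

lemma (in subfield) flow_exists:
  assumes G: "fps_nth G 0 = 0" "fps_nth G 1 = 1" "\<And>n. fps_nth G n \<in> K"
  shows "\<exists>\<psi>. fps_nth \<psi> 0 = 0 \<and> fps_nth \<psi> 1 = 1 \<and> (\<forall>n. fps_nth \<psi> n \<in> K) \<and>
              fps_X * fps_deriv \<psi> = G oo \<psi>"
proof -
  \<comment> \<open>With coefficients normalised by factorials, the coefficients of \<open>G(\<psi>)\<close> are the right-hand sides of variational
    equations, which are sums over partitions.\<close>
  define \<gamma> where "\<gamma> = (\<lambda>n. fact n * fps_nth G n)"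
  define T where "T = (\<lambda>(x :: nat \<Rightarrow> 'a) p. VE_coeff p * \<gamma> (size p) * monomial_value x p)"
  define \<Phi> where "\<Phi> = (\<lambda>x n. if n \<le> 1 then of_nat n
      else (\<Sum>p\<in>monomials n - {{#n#}}. T x p) / of_nat (n - 1))"
  have "\<exists>x. \<forall>n. x n = \<Phi> x n"
  proof (rule wf_recursion_exists[OF wf_less_than])
    fix x y :: "nat \<Rightarrow> 'a" and n assume xy: "\<And>z. (z, n) \<in> less_than \<Longrightarrow> x z = y z"
    have "T x p = T y p" if "p \<in> monomials n - {{#n#}}" for p
    proof -
      have "image_mset x p = image_mset y p"
        using that xy monomials_part_less[of p n] by (intro image_mset_cong) auto
      thus ?thesis by (simp add: T_def monomial_value_def)
    qed
    thus "\<Phi> x n = \<Phi> y n" by (simp add: \<Phi>_def)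
  qed
  then obtain x where x: "\<And>n. x n = \<Phi> x n" by blast
  have x01: "x 0 = 0" "x 1 = 1" using x[of 0] x[of 1] by (simp_all add: \<Phi>_def)
  have xK: "x n \<in> K" for n
  proof (induction n rule: less_induct)
    case (less n)
    have "T x p \<in> K" if "p \<in> monomials n - {{#n#}}" for p
      unfolding T_def \<gamma>_def using that monomials_part_less[of p n]
      by (intro mult_in VE_coeff_in fact_in G monomial_value_in less.IH) auto
    hence "(\<Sum>p\<in>monomials n - {{#n#}}. T x p) / of_nat (n - 1) \<in> K" by auto
    hence "\<Phi> x n \<in> K"
      by (cases "n \<le> 1") (simp_all only: \<Phi>_def if_True if_False of_nat_in)
    thus ?case by (subst x)
  qed
  have rec: "of_nat n * x n = VE_rhs \<gamma> x n" if n: "n \<ge> 1" for n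
  proof -
    have "VE_rhs \<gamma> x n = (\<Sum>p\<in>monomials n. T x p)"
      using VE_rhs_eq[OF n] by (simp add: T_def)
    also have "\<dots> = T x {#n#} + (\<Sum>p\<in>monomials n - {{#n#}}. T x p)"
      using n by (intro sum.remove) (auto simp: singleton_in_monomials)
    also have "T x {#n#} = x n" using G by (simp add: T_def \<gamma>_def monomial_value_def)
    also have "(\<Sum>p\<in>monomials n - {{#n#}}. T x p) = of_nat (n - 1) * x n"
    proof (cases "n = 1")
      case True
      have "monomials n - {{#n#}} = {}"
      proof -
        have False if p: "p \<in> monomials n" "p \<noteq> {#n#}" for p
        proof -
          have "p \<noteq> {#}" using p True by (auto simp: monomials_def)
          then obtain i where "i \<in># p" by blast
          with monomials_part_less[OF p this] p True show False by (auto simp: monomials_def)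
        qed
        thus ?thesis by blast
      qed
      thus ?thesis by (simp only: True) simp
    next
      case False
      thus ?thesis using n by (subst x) (simp add: \<Phi>_def)
    qed
    also have "x n + of_nat (n - 1) * x n = of_nat n * x n"
      using n by (simp add: of_nat_diff algebra_simps)
    finally show ?thesis ..
  qed
  define \<psi> where "\<psi> = Abs_fps (\<lambda>n. if n = 0 then 0 else x n / fact n)"
  have "Abs_fps (\<lambda>n. \<gamma> n / fact n) = G" by (rule fps_ext) (simp add: \<gamma>_def)
  hence VE: "VE_rhs \<gamma> x n = fact n * fps_nth (G oo \<psi>) n" for n
    by (simp add: VE_rhs_def \<psi>_def)
  have "fps_X * fps_deriv \<psi> = G oo \<psi>"
  proof (rule fps_ext)
    fix n
    show "fps_nth (fps_X * fps_deriv \<psi>) n = fps_nth (G oo \<psi>) n"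
    proof (cases n)
      case 0
      thus ?thesis by (simp add: G)
    next
      case (Suc m)
      have "fact n * fps_nth (fps_X * fps_deriv \<psi>) n = of_nat n * x n"
        by (simp add: Suc \<psi>_def)
      also have "\<dots> = fact n * fps_nth (G oo \<psi>) n" using rec[of n] VE Suc by simp
      finally show ?thesis by simp
    qed
  qed
  moreover have "fps_nth \<psi> n \<in> K" for n using xK by (auto simp: \<psi>_def)
  ultimately show ?thesis using x01 by (intro exI[of _ \<psi>]) (auto simp: \<psi>_def)
qed

lemma derivation_fps_coeff_deriv:
  assumes "derivation \<delta>"
  shows "derivation (fps_coeff_deriv \<delta>)"
  unfolding derivation_def
  by (auto intro!: fps_ext simp: derivation_add[OF assms] fps_mult_nth derivation_sum[OF assms]
        derivation_mult[OF assms] sum.distrib)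

lemma derivation_power:
  assumes d: "derivation d"
  shows "d (x ^ n) = of_nat n * x ^ (n - 1) * d x"
proof (induction n)
  case 0
  show ?case by (simp add: derivation_1[OF d])
next
  case (Suc n)
  thus ?case by (cases n) (simp_all add: derivation_mult[OF d] algebra_simps)
qed

text \<open>
  A composition may be computed with any sufficiently long partial sum of the outer series.
\<close>

lemma fps_compose_mult_nth:
  fixes H \<psi> Y :: "'a::idom fps"
  assumes "fps_nth \<psi> 0 = 0" "n \<le> N"
  shows "fps_nth ((H oo \<psi>) * Y) n = (\<Sum>i=0..N. fps_nth H i * fps_nth (\<psi> ^ i * Y) n)"
proof -
  have "fps_nth (H oo \<psi>) j = (\<Sum>i=0..N. fps_nth H i * fps_nth (\<psi> ^ i) j)" if "j \<le> n" for j
    unfolding fps_compose_nth using that assms startsby_zero_power_prefix[OF assms(1)]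
    by (intro sum.mono_neutral_left) auto
  hence "fps_nth ((H oo \<psi>) * Y) n
      = (\<Sum>j=0..n. \<Sum>i=0..N. fps_nth H i * fps_nth (\<psi> ^ i) j * fps_nth Y (n - j))"
    by (simp add: fps_mult_nth sum_distrib_right)
  also have "\<dots> = (\<Sum>i=0..N. fps_nth H i * fps_nth (\<psi> ^ i * Y) n)"
    by (subst sum.swap) (simp add: fps_mult_nth sum_distrib_left mult.assoc)
  finally show ?thesis .
qed

lemma fps_coeff_deriv_compose:
  fixes F \<psi> :: "'a::idom fps"
  assumes d: "derivation \<delta>" and \<psi>: "fps_nth \<psi> 0 = 0"
  shows "fps_coeff_deriv \<delta> (F oo \<psi>)
       = (fps_coeff_deriv \<delta> F oo \<psi>) + (fps_deriv F oo \<psi>) * fps_coeff_deriv \<delta> \<psi>"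
proof (rule fps_ext)
  fix n
  note D = derivation_fps_coeff_deriv[OF d]
  have "fps_nth (fps_coeff_deriv \<delta> (F oo \<psi>)) n
      = (\<Sum>i=0..n. \<delta> (fps_nth F i) * fps_nth (\<psi> ^ i) n + fps_nth F i * \<delta> (fps_nth (\<psi> ^ i) n))"
    by (simp add: fps_compose_nth derivation_sum[OF d] derivation_mult[OF d])
  also have "\<dots> = fps_nth (fps_coeff_deriv \<delta> F oo \<psi>) n
      + (\<Sum>i=0..n. fps_nth F i * fps_nth (fps_coeff_deriv \<delta> (\<psi> ^ i)) n)"
    by (simp add: sum.distrib fps_compose_nth)
  also have "(\<Sum>i=0..n. fps_nth F i * fps_nth (fps_coeff_deriv \<delta> (\<psi> ^ i)) n)
      = (\<Sum>i=0..Suc n. fps_nth F i * fps_nth (fps_coeff_deriv \<delta> (\<psi> ^ i)) n)"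
  proof -
    have "fps_nth (\<psi> ^ Suc n) n = 0" using startsby_zero_power_prefix[OF \<psi>] by blast
    thus ?thesis by (simp add: derivation_0[OF d])
  qed
  also have "\<dots> = (\<Sum>i=0..n. fps_nth F (Suc i) * fps_nth (fps_coeff_deriv \<delta> (\<psi> ^ Suc i)) n)"
    by (subst sum.atLeast0_atMost_Suc_shift) (simp add: derivation_1[OF D] derivation_0[OF d])
  also have "\<dots> = fps_nth ((fps_deriv F oo \<psi>) * fps_coeff_deriv \<delta> \<psi>) n"
  proof -
    have "fps_coeff_deriv \<delta> (\<psi> ^ Suc i) = fps_const (of_nat (Suc i)) * (\<psi> ^ i * fps_coeff_deriv \<delta> \<psi>)" for i
      by (simp only: derivation_power[OF D] fps_of_nat diff_Suc_1 mult.assoc)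
    hence "fps_nth (fps_coeff_deriv \<delta> (\<psi> ^ Suc i)) n
        = of_nat (Suc i) * fps_nth (\<psi> ^ i * fps_coeff_deriv \<delta> \<psi>) n" for i
      by (simp only: fps_mult_left_const_nth)
    thus ?thesis
      unfolding fps_compose_mult_nth[OF \<psi> order_refl]
      by (intro sum.cong refl) (simp add: mult_ac del: power_Suc)
  qed
  finally show "fps_nth (fps_coeff_deriv \<delta> (F oo \<psi>)) n
      = fps_nth ((fps_coeff_deriv \<delta> F oo \<psi>) + (fps_deriv F oo \<psi>) * fps_coeff_deriv \<delta> \<psi>) n"
    by simp
qed

text \<open>
  The coefficient of \<open>v\<^sup>n\<close> gives \<open>(n - 1) Z\<^sub>n = 0\<close> once the lower coefficients vanish; so 1 is the only possible
  order.
\<close>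

lemma fuchsian_unique_zero:
  fixes Z :: "'a::field_char_0 fps"
  assumes eq: "fps_X * fps_deriv Z = g * Z" and g: "fps_nth g 0 = 1"
    and Z: "fps_nth Z 0 = 0" "fps_nth Z 1 = 0"
  shows "Z = 0"
proof -
  have "fps_nth Z n = 0" for n
  proof (induction n rule: less_induct)
    case (less n)
    show ?case
    proof (cases "n \<le> 1")
      case True
      thus ?thesis using Z by (cases n) auto
    next
      case False
      then obtain m where m: "n = Suc m" by (cases n) auto
      have "of_nat n * fps_nth Z n = fps_nth (g * Z) n" by (simp flip: eq add: m)
      also have "\<dots> = fps_nth g 0 * fps_nth Z n"
        unfolding fps_mult_nth
        by (subst sum.atLeast_Suc_atMost) (auto intro!: sum.neutral less.IH)
      finally have "of_nat m * fps_nth Z n = 0" using g by (simp add: m algebra_simps)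
      thus ?thesis using False m by simp
    qed
  qed
  thus ?thesis by (intro fps_ext) simp
qed

text \<open>
  The equation for \<open>G\<close> says that \<open>G \<partial>\<^sub>u\<close> commutes with \<open>\<delta> + \<omega> \<partial>\<^sub>u\<close>, and \<open>v \<partial>\<^sub>v\<close> commutes with \<open>\<delta> + \<omega>\<^sub>1 v \<partial>\<^sub>v\<close>.
  Hence the defect \<open>Z\<close>, the difference of the two sides, satisfies the equation \<open>v Z' = G'(\<psi>) Z\<close> of infinitesimal
  variations of the flow. It vanishes to second order, and therefore identically.
\<close>

lemma flow_linearises:
  fixes G \<psi> \<omega> :: "'a::field_char_0 fps"
  assumes d: "derivation \<delta>" and \<omega>: "fps_nth \<omega> 0 = 0"
    and G: "fps_nth G 0 = 0" "fps_nth G 1 = 1"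
    and comm: "fps_coeff_deriv \<delta> G + \<omega> * fps_deriv G = fps_deriv \<omega> * G"
    and \<psi>: "fps_nth \<psi> 0 = 0" "fps_nth \<psi> 1 = 1" and flow: "fps_X * fps_deriv \<psi> = G oo \<psi>"
  shows "fps_coeff_deriv \<delta> \<psi> + fps_const (fps_nth \<omega> 1) * (fps_X * fps_deriv \<psi>) = \<omega> oo \<psi>"
proof -
  let ?b = "fps_const (fps_nth \<omega> 1)"
  let ?g = "fps_deriv G oo \<psi>"
  note comp = fps_compose_mult_distrib[OF \<psi>(1)]
  define Z where "Z = fps_coeff_deriv \<delta> \<psi> + ?b * (fps_X * fps_deriv \<psi>) - (\<omega> oo \<psi>)"
  have "fps_X * fps_deriv (fps_coeff_deriv \<delta> \<psi>) = fps_coeff_deriv \<delta> (fps_X * fps_deriv \<psi>)"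
  proof (rule fps_ext)
    fix n
    show "fps_nth (fps_X * fps_deriv (fps_coeff_deriv \<delta> \<psi>)) n
        = fps_nth (fps_coeff_deriv \<delta> (fps_X * fps_deriv \<psi>)) n"
      using derivation_of_nat[OF d, of n]
      by (cases n) (simp_all add: derivation_mult[OF d] derivation_0[OF d])
  qed
  hence 1: "fps_X * fps_deriv (fps_coeff_deriv \<delta> \<psi>)
      = (fps_coeff_deriv \<delta> G oo \<psi>) + ?g * fps_coeff_deriv \<delta> \<psi>"
    by (simp add: flow fps_coeff_deriv_compose[OF d \<psi>(1)])
  have 2: "fps_X * fps_deriv (?b * (fps_X * fps_deriv \<psi>)) = ?g * (?b * (fps_X * fps_deriv \<psi>))"
  proof -
    have "fps_deriv (fps_X * fps_deriv \<psi>) = ?g * fps_deriv \<psi>"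
      unfolding flow by (rule fps_compose_deriv[OF \<psi>(1)])
    hence "?b * (fps_X * fps_deriv (fps_X * fps_deriv \<psi>)) = ?g * (?b * (fps_X * fps_deriv \<psi>))"
      by (simp only: mult_ac)
    moreover have "fps_X * fps_deriv (?b * (fps_X * fps_deriv \<psi>))
        = ?b * (fps_X * fps_deriv (fps_X * fps_deriv \<psi>))"
      by (subst fps_deriv_mult_const_left) (rule mult.left_commute)
    ultimately show ?thesis by simp
  qed
  have 3: "fps_X * fps_deriv (\<omega> oo \<psi>) = (fps_coeff_deriv \<delta> G oo \<psi>) + ?g * (\<omega> oo \<psi>)"
  proof -
    have "fps_X * fps_deriv (\<omega> oo \<psi>) = (fps_deriv \<omega> oo \<psi>) * (fps_X * fps_deriv \<psi>)"
      by (simp add: fps_compose_deriv[OF \<psi>(1)] mult_ac)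
    also have "\<dots> = (fps_deriv \<omega> * G) oo \<psi>" by (simp add: flow comp)
    also have "\<dots> = (fps_coeff_deriv \<delta> G oo \<psi>) + ?g * (\<omega> oo \<psi>)"
      unfolding comm[symmetric] fps_compose_add_distrib comp by (simp add: mult.commute)
    finally show ?thesis .
  qed
  have "fps_X * fps_deriv Z = ?g * Z"
    using 1 2 3 by (simp add: Z_def right_diff_distrib distrib_left)
  moreover have "fps_nth ?g 0 = 1" using G by simp
  moreover have "fps_nth Z 0 = 0" using \<psi> \<omega> by (simp add: Z_def derivation_0[OF d])
  moreover have "fps_nth Z 1 = 0"
    using \<psi> \<omega> by (simp add: Z_def derivation_1[OF d] fps_compose_nth)
  ultimately have "Z = 0" by (rule fuchsian_unique_zero)
  thus ?thesis by (simp add: Z_def)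
qed

section \<open>Diagonalising the linearised variational equations\<close>

lemma monomial_value_add_mset: "monomial_value y (add_mset i m) = y i * monomial_value y m"
  by (simp add: monomial_value_def)

lemma monomial_value_union: "monomial_value y (p + q) = monomial_value y p * monomial_value y q"
  by (simp add: monomial_value_def)

lemma monomials_size_pos: "p \<in> monomials i \<Longrightarrow> i \<noteq> 0 \<Longrightarrow> size p \<ge> 1"
  by (cases p) (auto simp: monomials_def)

lemma fls_const_sum: "fls_const (sum f A) = (\<Sum>i\<in>A. fls_const (f i :: 'a::comm_monoid_add))"
  by (induction A rule: infinite_finite_induct) (simp_all flip: fls_plus_const)

lemma fls_const_VE_coeff: "fls_const (VE_coeff p) = (VE_coeff p :: 'a::field_char_0 fls)"
proof -
  define A B where "A = (fact (sum_mset p) :: nat)"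
    and "B = (\<Prod>j\<in>set_mset p. fact (count p j) * fact j ^ count p j :: nat)"
  have "(VE_coeff p :: 'a) = of_nat A * inverse (of_nat B)"
    "(VE_coeff p :: 'a fls) = of_nat A * inverse (of_nat B)"
    by (simp_all add: VE_coeff_def A_def B_def divide_inverse)
  thus ?thesis by (simp only: fls_of_nat fls_inverse_const fls_const_mult_const)
qed

text \<open>
  Composition with the series \<open>\<Sum>\<^sub>n x\<^sub>n v\<^sup>n / n!\<close>, which is tangent to the identity, acts on the monomials of weight \<open>k\<close> by a
  matrix that does not depend on \<open>v\<close>. It is unitriangular with respect to the degree: in the expansion of a product, the
  degree is preserved only by choosing the linear term of every factor.
\<close>

lemma (in subfield) monomial_substitution:
  assumes x: "\<And>n. x n \<in> K" "x 1 = 1" and m: "m \<in> monomials k"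
  shows "\<exists>\<tau>. (\<forall>n. \<tau> n \<in> K) \<and> \<tau> m = 1 \<and> (\<forall>n. \<tau> n \<noteq> 0 \<longrightarrow> n = m \<or> size m < size n) \<and>
    (\<forall>v. monomial_value (VE_rhs (\<lambda>n. fls_const (x n)) v) m
        = (\<Sum>n\<in>monomials k. fls_const (\<tau> n) * monomial_value v n))"
  using m
proof (induction m arbitrary: k)
  case empty
  hence k: "k = 0" by (simp add: monomials_def)
  have "monomials 0 = {{#}}"
    by (auto simp: monomials_def) (metis multi_nonempty_split union_single_eq_member)
  thus ?case
    by (intro exI[of _ "\<lambda>n. if n = {#} then 1 else 0"]) (simp add: k monomial_value_def)
next
  case (add i m)
  define k' where "k' = sum_mset m"
  have i: "i \<noteq> 0" and k: "k = i + k'" and m: "m \<in> monomials k'"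
    using add.prems by (auto simp: monomials_def k'_def)
  obtain \<tau>' where \<tau>'K: "\<And>n. \<tau>' n \<in> K" and \<tau>'m: "\<tau>' m = 1"
    and \<tau>'n: "\<And>n. \<tau>' n \<noteq> 0 \<Longrightarrow> n = m \<or> size m < size n"
    and \<tau>': "\<And>v. monomial_value (VE_rhs (\<lambda>n. fls_const (x n)) v) m
        = (\<Sum>n\<in>monomials k'. fls_const (\<tau>' n) * monomial_value v n)"
    using add.IH[OF m] by blast
  define S where "S = monomials i \<times> monomials k'"
  define a where "a = (\<lambda>(p, n). VE_coeff p * x (size p) * \<tau>' n)"
  define \<tau> where "\<tau> = (\<lambda>n. \<Sum>q\<in>{q \<in> S. fst q + snd q = n}. a q)"
  have finS: "finite S" by (simp add: S_def)
  have lead: "q = ({#i#}, m)" if q: "q \<in> S" "a q \<noteq> 0" "size (fst q + snd q) \<le> Suc (size m)" for q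
  proof -
    obtain p n where pn: "q = (p, n)" by force
    have p: "p \<in> monomials i" "size p \<ge> 1" using q monomials_size_pos i by (auto simp: S_def pn)
    have "n = m \<or> size m < size n" using q \<tau>'n by (auto simp: a_def pn)
    hence "n = m" "size p = 1" using q p by (auto simp: pn)
    moreover from this have "p = {#i#}"
      using p size_1_singleton_mset[of p] by (auto simp: monomials_def)
    ultimately show ?thesis by (simp add: pn)
  qed
  have lead_in: "({#i#}, m) \<in> S" using i m by (simp add: S_def singleton_in_monomials)
  have "\<tau> n \<in> K" for n
    unfolding \<tau>_def a_def by (auto intro!: sum_in mult_in VE_coeff_in x \<tau>'K)
  moreover have "\<tau> (add_mset i m) = 1"
  proof -
    have "\<tau> (add_mset i m) = (\<Sum>q\<in>{({#i#}, m)}. a q)"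
      unfolding \<tau>_def
    proof (rule sum.mono_neutral_right)
      show "finite {q \<in> S. fst q + snd q = add_mset i m}" using finS by simp
      show "{({#i#}, m)} \<subseteq> {q \<in> S. fst q + snd q = add_mset i m}" using lead_in by simp
      show "\<forall>q\<in>{q \<in> S. fst q + snd q = add_mset i m} - {({#i#}, m)}. a q = 0"
      proof
        fix q assume q: "q \<in> {q \<in> S. fst q + snd q = add_mset i m} - {({#i#}, m)}"
        hence "size (fst q + snd q) \<le> Suc (size m)" by simp
        thus "a q = 0" using lead[of q] q by blast
      qed
    qed
    thus ?thesis using x by (simp add: a_def \<tau>'m)
  qed
  moreover have "n = add_mset i m \<or> size (add_mset i m) < size n" if nz: "\<tau> n \<noteq> 0" for n
  proof -
    obtain q where q: "q \<in> S" "fst q + snd q = n" "a q \<noteq> 0"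
      using sum.not_neutral_contains_not_neutral[OF nz[unfolded \<tau>_def]] by blast
    show ?thesis using lead[OF q(1,3)] q(2) by (cases "size n \<le> Suc (size m)") auto
  qed
  moreover have "monomial_value (VE_rhs (\<lambda>n. fls_const (x n)) v) (add_mset i m)
      = (\<Sum>n\<in>monomials k. fls_const (\<tau> n) * monomial_value v n)" for v
  proof -
    have c: "fls_const (VE_coeff p) = (VE_coeff p :: 'a fls)" for p
      by (rule fls_const_VE_coeff)
    have "VE_rhs (\<lambda>n. fls_const (x n)) v i
        = (\<Sum>p\<in>monomials i. fls_const (VE_coeff p * x (size p)) * monomial_value v p)"
      using i by (simp add: VE_rhs_eq c flip: fls_const_mult_const)
    hence "monomial_value (VE_rhs (\<lambda>n. fls_const (x n)) v) (add_mset i m)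
       = (\<Sum>p\<in>monomials i. \<Sum>n\<in>monomials k'. fls_const (VE_coeff p * x (size p)) * monomial_value v p
             * (fls_const (\<tau>' n) * monomial_value v n))"
      by (simp add: monomial_value_add_mset \<tau>' sum_product)
    also have "\<dots> = (\<Sum>q\<in>S. fls_const (a q) * monomial_value v (fst q + snd q))"
      unfolding S_def sum.cartesian_product
      by (intro sum.cong refl)
         (auto simp: a_def monomial_value_union mult_ac simp flip: fls_const_mult_const)
    also have "\<dots> = (\<Sum>n\<in>monomials k. \<Sum>q\<in>{q \<in> S. fst q + snd q = n}.
        fls_const (a q) * monomial_value v (fst q + snd q))"
    proof (rule sum.group[symmetric])
      show "(\<lambda>q. fst q + snd q) ` S \<subseteq> monomials k"
        by (auto simp: S_def monomials_def k)
    qed (simp_all add: finS)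
    also have "\<dots> = (\<Sum>n\<in>monomials k. fls_const (\<tau> n) * monomial_value v n)"
    proof (intro sum.cong refl)
      fix n
      have "(\<Sum>q\<in>{q \<in> S. fst q + snd q = n}. fls_const (a q)) = fls_const (\<tau> n)"
        unfolding \<tau>_def fls_const_sum ..
      thus "(\<Sum>q\<in>{q \<in> S. fst q + snd q = n}. fls_const (a q) * monomial_value v (fst q + snd q))
          = fls_const (\<tau> n) * monomial_value v n"
        by (simp flip: sum_distrib_right)
    qed
    finally show ?thesis .
  qed
  ultimately show ?case by blast
qed

text \<open>
  The relation extends from the powers to all polynomials in \<open>N i\<close>, in particular to the one that vanishes at all points
  except \<open>N j\<close>.
\<close>

lemma powers_independent:
  fixes a :: "'i \<Rightarrow> 'a::field_char_0" and N :: "'i \<Rightarrow> nat"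
  assumes fin: "finite I" and inj: "inj_on N I"
    and 0: "\<And>t :: nat. (\<Sum>i\<in>I. a i * of_nat (N i ^ t)) = 0" and j: "j \<in> I"
  shows "a j = 0"
proof -
  have poly: "(\<Sum>i\<in>I. a i * poly q (of_nat (N i))) = 0" for q :: "'a poly"
  proof -
    have "(\<Sum>i\<in>I. a i * poly q (of_nat (N i)))
        = (\<Sum>t\<le>degree q. coeff q t * (\<Sum>i\<in>I. a i * of_nat (N i ^ t)))"
      unfolding poly_altdef sum_distrib_left by (subst sum.swap) (simp add: mult_ac)
    thus ?thesis unfolding 0 by simp
  qed
  define q where "q = (\<Prod>i\<in>I - {j}. [:- of_nat (N i), 1:] :: 'a poly)"
  have q: "poly q (of_nat (N i)) = 0" if "i \<in> I - {j}" for i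
    using that fin by (auto simp: q_def poly_prod prod_zero_iff)
  have "(\<Sum>i\<in>I. a i * poly q (of_nat (N i))) = a j * poly q (of_nat (N j))"
    using fin j q by (subst sum.remove[of _ j]) (auto intro!: sum.neutral)
  moreover have "poly q (of_nat (N j)) \<noteq> 0"
    using fin j inj by (auto simp: q_def poly_prod prod_zero_iff inj_on_def)
  ultimately show ?thesis using poly[of q] by simp
qed

lemma injective_primes: "\<exists>\<pi> :: nat \<Rightarrow> nat. inj \<pi> \<and> (\<forall>j. prime (\<pi> j))"
proof -
  have inf: "infinite {p :: nat. prime p}" by (rule primes_infinite)
  show ?thesis
    by (intro exI[of _ "enumerate {p. prime p}"])
       (use enumerate_in_set[OF inf] strict_mono_enumerate[OF inf] in \<open>auto dest: strict_mono_imp_inj_on\<close>)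
qed

text \<open>
  By unique factorisation, monomials evaluated at distinct primes take distinct values. Together with the preceding lemma
  this separates monomials by integral values of the variables.
\<close>

lemma prime_monomial_inj:
  fixes \<pi> :: "nat \<Rightarrow> nat"
  assumes "inj \<pi>" "\<And>j. prime (\<pi> j)"
  shows "inj (monomial_value \<pi>)"
proof (rule injI)
  fix m n assume eq: "monomial_value \<pi> m = monomial_value \<pi> n"
  have "prime_factorization (monomial_value \<pi> m) = image_mset \<pi> m" for m
    unfolding monomial_value_def
    by (rule prime_factorization_prod_mset_primes) (use assms in auto)
  hence "image_mset \<pi> m = image_mset \<pi> n" using eq by metis
  thus "m = n" using assms(1) by (metis multiset.inj_map injD)
qed

text \<open>
  Coefficients in a field regarded as constant Laurent series. The Laurent variable \<open>s\<close> will serve as a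
  solution of \<open>s' = b s\<close>.
\<close>

definition fps_lift :: "'a::zero fps \<Rightarrow> 'a fls fps" where
  "fps_lift F = Abs_fps (\<lambda>n. fls_const (fps_nth F n))"

lemma fps_lift_nth [simp]: "fps_nth (fps_lift F) n = fls_const (fps_nth F n)"
  by (simp add: fps_lift_def)

lemma fps_lift_add: "fps_lift (F + G) = fps_lift F + fps_lift (G :: 'a::comm_ring_1 fps)"
  by (rule fps_ext) (simp add: fls_plus_const)

lemma fps_lift_mult: "fps_lift (F * G) = fps_lift F * fps_lift (G :: 'a::comm_ring_1 fps)"
  by (rule fps_ext) (simp add: fps_mult_nth fls_const_sum)

lemma fps_lift_power: "fps_lift (F ^ n) = fps_lift (F :: 'a::comm_ring_1 fps) ^ n"
proof (induction n)
  case 0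
  have "fps_lift (1 :: 'a fps) = 1" by (rule fps_ext) simp
  thus ?case by simp
qed (simp add: fps_lift_mult)

lemma fps_lift_compose: "fps_lift (F oo G) = fps_lift F oo fps_lift (G :: 'a::comm_ring_1 fps)"
  by (rule fps_ext)
     (simp add: fps_compose_nth fls_const_sum flip: fps_lift_power fls_const_mult_const)

lemma fps_lift_const: "fps_lift (fps_const a) = fps_const (fls_const (a :: 'a::comm_ring_1))"
  by (rule fps_ext) simp

lemma fps_lift_X: "fps_lift fps_X = (fps_X :: 'a::comm_ring_1 fls fps)"
  by (rule fps_ext) (simp add: fps_X_def)

lemma fps_lift_deriv: "fps_lift (fps_deriv F) = fps_deriv (fps_lift (F :: 'a::comm_ring_1 fps))"
  by (rule fps_ext) (simp add: fls_of_nat fls_plus_const flip: fls_const_mult_const)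

lemma fls_const_fact: "fls_const (fact n) = (fact n :: 'a::field_char_0 fls)"
proof -
  have "fls_const (of_nat (fact n)) = (of_nat (fact n) :: 'a fls)" by (simp only: fls_of_nat)
  thus ?thesis by simp
qed

text \<open>
  A linearisation \<open>\<psi>\<close> turns solutions \<open>v\<close> of the uncoupled equations \<open>v\<^sub>j' = b v\<^sub>j\<close> into solutions of the
  variational equations.
\<close>

lemma linearisation_solves_VE:
  fixes \<psi> \<omega> :: "'a::field_char_0 fps" and d :: "'a fls \<Rightarrow> 'a fls"
  assumes d: "derivation d" and d\<delta>: "\<And>a. d (fls_const a) = fls_const (\<delta> a)"
    and \<psi>: "fps_nth \<psi> 0 = 0"
    and lin: "fps_coeff_deriv \<delta> \<psi> + fps_const b * (fps_X * fps_deriv \<psi>) = \<omega> oo \<psi>"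
    and v: "\<And>j. d (v j) = fls_const b * v j"
    and \<gamma>: "\<And>n. n \<noteq> 0 \<Longrightarrow> \<gamma> n = fact n * fps_nth \<omega> n"
    and \<omega>: "fps_nth \<omega> 0 = 0"
    and y: "y = VE_rhs (\<lambda>n. fls_const (fact n * fps_nth \<psi> n)) v" and i: "i \<ge> 1"
  shows "d (y i) = VE_rhs (\<lambda>n. fls_const (\<gamma> n)) y i"
proof -
  have dfact: "d (fact j * z) = fact j * d z" for j z
    using derivation_of_nat[OF d, of "fact j"] by (simp add: derivation_mult[OF d])
  define V where "V = Abs_fps (\<lambda>j. if j = 0 then 0 else v j / fact j)"
  have V0: "fps_nth V 0 = 0" by (simp add: V_def)
  define Y where "Y = fps_lift \<psi> oo V"
  have lp: "fps_nth (fps_lift \<psi>) 0 = 0" by (simp add: \<psi>)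
  have Y0: "fps_nth Y 0 = 0" by (simp add: Y_def \<psi>)
  have "Abs_fps (\<lambda>n. fls_const (fact n * fps_nth \<psi> n) / fact n) = fps_lift \<psi>"
    by (rule fps_ext) (simp add: fls_const_fact flip: fls_const_mult_const)
  hence yY: "y j = fact j * fps_nth Y j" for j
    by (simp add: y VE_rhs_def V_def[symmetric] Y_def)
  hence Yy: "Abs_fps (\<lambda>j. if j = 0 then 0 else y j / fact j) = Y"
    by (intro fps_ext) (simp add: Y0)
  have dV: "fps_coeff_deriv d V = fps_const (fls_const b) * V"
  proof (rule fps_ext)
    fix j
    have "fact j * d (v j / fact j) = fls_const b * v j"
      unfolding dfact[symmetric] by (simp add: v)
    hence "d (v j / fact j) = fls_const b * v j / fact j" by (simp add: nonzero_eq_divide_eq mult.commute)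
    thus "fps_nth (fps_coeff_deriv d V) j = fps_nth (fps_const (fls_const b) * V) j"
      by (simp add: V_def derivation_0[OF d])
  qed
  have lift: "fps_coeff_deriv d (fps_lift F) = fps_lift (fps_coeff_deriv \<delta> F)" for F
    by (rule fps_ext) (simp add: d\<delta>)
  have "fps_coeff_deriv d Y = (fps_lift (fps_coeff_deriv \<delta> \<psi>) oo V)
      + (fps_deriv (fps_lift \<psi>) oo V) * (fps_const (fls_const b) * V)"
    unfolding Y_def fps_coeff_deriv_compose[OF d V0] lift dV ..
  also have "\<dots> = fps_lift (fps_coeff_deriv \<delta> \<psi> + fps_const b * (fps_X * fps_deriv \<psi>)) oo V"
    by (simp add: fps_lift_add fps_lift_mult fps_lift_const fps_lift_X fps_lift_deriv V0
          fps_compose_add_distrib fps_compose_mult_distrib[OF V0] mult_ac)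
  also have "\<dots> = fps_lift \<omega> oo Y"
    unfolding lin fps_lift_compose Y_def by (rule fps_compose_assoc[OF V0 lp, symmetric])
  finally have dY: "fps_coeff_deriv d Y = fps_lift \<omega> oo Y" .
  have "Abs_fps (\<lambda>n. fls_const (\<gamma> n) / fact n) = fps_lift \<omega> + fps_const (fls_const (\<gamma> 0))"
  proof (rule fps_ext)
    fix n
    show "fps_nth (Abs_fps (\<lambda>n. fls_const (\<gamma> n) / fact n)) n
        = fps_nth (fps_lift \<omega> + fps_const (fls_const (\<gamma> 0))) n"
    proof (cases "n = 0")
      case False
      thus ?thesis by (simp add: \<gamma> fls_const_fact flip: fls_const_mult_const)
    qed (simp add: \<omega>)
  qed
  hence "VE_rhs (\<lambda>n. fls_const (\<gamma> n)) y i = fact i * fps_nth (fps_lift \<omega> oo Y) i"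
    using i unfolding VE_rhs_def Yy by (simp add: fps_compose_add_distrib)
  also have "\<dots> = fact i * d (fps_nth Y i)" by (simp flip: dY)
  also have "\<dots> = d (y i)" by (simp add: yY dfact)
  finally show ?thesis ..
qed

lemma LVE_matrix_fls_const:
  "LVE_matrix (\<lambda>n. fls_const (\<gamma> n)) m n = fls_const (LVE_matrix \<gamma> m n :: 'a::field_char_0)"
  unfolding LVE_matrix_def
  by (simp add: fls_const_sum fls_of_nat fls_const_VE_coeff[symmetric] flip: fls_const_mult_const)

lemma monomial_value_scaled:
  "monomial_value (\<lambda>j. fls_const (a j) * fls_X) m
     = fls_const (monomial_value a m :: 'a::field) * fls_X ^ size m"
  by (induction m) (simp_all add: monomial_value_def mult_ac flip: fls_const_mult_const)

context irregular_curve
begin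

text \<open>
  Take \<open>v\<^sub>j = a\<^sub>j s\<close> with integers \<open>a\<^sub>j\<close> and \<open>s' = \<beta>\<^sub>1 s\<close>. The monomials in the resulting solution \<open>y\<close> of the variational
  equations can be differentiated in two ways: by \<open>LVE\<^sub>k\<close>, or by expanding them in the monomials of \<open>v\<close>. The difference of
  the results is a linear relation between the monomials in \<open>v\<close>, and since the \<open>a\<^sub>j\<close> are arbitrary, its coefficients,
  which are the entries of the asserted matrix identity, vanish.
\<close>

theorem LVE_diagonalisable:
  assumes int: "rationally_integrable (Fract P 1, Fract Q 1)"
  shows "\<exists>T. (\<forall>m n. T m n \<in> K) \<and>
    (\<forall>m\<in>monomials k. T m m = 1 \<and> (\<forall>n. T m n \<noteq> 0 \<longrightarrow> n = m \<or> size m < size n)) \<and>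
    (\<forall>m\<in>monomials k. \<forall>n\<in>monomials k.
       (\<Sum>l\<in>monomials k. LVE_matrix \<beta> m l * T l n) = \<delta> (T m n) + of_nat (size n) * \<beta> 1 * T m n)"
proof -
  obtain G :: "'a fps" where G: "fps_nth G 0 = 0" "fps_nth G 1 = 1" "\<And>n. fps_nth G n \<in> K"
    and comm: "fps_coeff_deriv \<delta> G + transversal * fps_deriv G = fps_deriv transversal * G"
    using infinitesimal_symmetry[OF int] by blast
  obtain \<psi> where \<psi>: "fps_nth \<psi> 0 = 0" "fps_nth \<psi> 1 = 1" "\<And>n. fps_nth \<psi> n \<in> K"
    and flow: "fps_X * fps_deriv \<psi> = G oo \<psi>"
    using K.flow_exists[OF G] by blast
  have tr: "fps_nth transversal 0 = 0" "fps_nth transversal 1 = \<beta> 1" by (simp_all add: transversal_def)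
  have lin: "fps_coeff_deriv \<delta> \<psi> + fps_const (\<beta> 1) * (fps_X * fps_deriv \<psi>) = transversal oo \<psi>"
    using flow_linearises[OF deriv_\<delta> tr(1) G(1,2) comm \<psi>(1,2) flow] unfolding tr(2) .
  define x where "x = (\<lambda>n. fact n * fps_nth \<psi> n)"
  have x: "x n \<in> K" "x 1 = 1" for n using \<psi> by (auto simp: x_def)
  define expands where "expands = (\<lambda>m \<tau>. (\<forall>n. \<tau> n \<in> K) \<and> \<tau> m = 1 \<and>
      (\<forall>n. \<tau> n \<noteq> 0 \<longrightarrow> n = m \<or> size m < size n) \<and>
      (\<forall>v. monomial_value (VE_rhs (\<lambda>n. fls_const (x n)) v) m
        = (\<Sum>n\<in>monomials k. fls_const (\<tau> n) * monomial_value v n)))"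
  have "\<forall>m\<in>monomials k. \<exists>\<tau>. expands m \<tau>"
    unfolding expands_def by (intro ballI K.monomial_substitution x)
  from bchoice[OF this] obtain T0 where T0: "\<forall>m\<in>monomials k. expands m (T0 m)" by (elim exE)
  define T where "T = (\<lambda>m n. if m \<in> monomials k then T0 m n else 0)"
  have TK: "T m n \<in> K" for m n using T0 by (simp add: T_def expands_def)
  have T1: "T m m = 1" "T m n \<noteq> 0 \<Longrightarrow> n = m \<or> size m < size n" if "m \<in> monomials k" for m n
    using T0 that by (auto simp: T_def expands_def)
  have subst: "monomial_value (VE_rhs (\<lambda>n. fls_const (x n)) v) m
        = (\<Sum>n\<in>monomials k. fls_const (T m n) * monomial_value v n)" if "m \<in> monomials k" for m v
    using T0 that by (simp add: T_def expands_def)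

  define d where "d = fls_vf \<delta> (fls_const (\<beta> 1) * fls_X)"
  have der: "derivation d" unfolding d_def by (rule derivation_fls_vf[OF deriv_\<delta>])
  have d_const: "d (fls_const a) = fls_const (\<delta> a)" and d_X: "d fls_X = fls_const (\<beta> 1) * fls_X" for a
    by (simp_all add: d_def fls_vf_const fls_vf_X deriv_\<delta>)
  have d_power: "d (fls_X ^ r) = of_nat r * fls_const (\<beta> 1) * fls_X ^ r" for r
    by (induction r) (simp_all add: derivation_1[OF der] derivation_mult[OF der] d_X algebra_simps)

  obtain \<pi> :: "nat \<Rightarrow> nat" where \<pi>: "inj \<pi>" "\<And>j. prime (\<pi> j)" using injective_primes by blast
  define N where "N = monomial_value \<pi>"
  define C where "C = (\<lambda>m n. (\<Sum>l\<in>monomials k. LVE_matrix \<beta> m l * T l n)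
      - (\<delta> (T m n) + of_nat (size n) * \<beta> 1 * T m n))"

  \<comment> \<open>Here \<open>a\<^sub>j\<close> is the power \<open>t\<close> of the prime \<open>\<pi> j\<close>, so that the monomial \<open>n\<close> takes the value \<open>N n ^ t * s ^ size n\<close>.\<close>
  have key: "(\<Sum>n\<in>monomials k. fls_const (C m n) * (fls_const (of_nat (N n ^ t)) * fls_X ^ size n)) = 0"
    if m: "m \<in> monomials k" for m and t :: nat
  proof -
    define v where "v = (\<lambda>j. fls_const (of_nat (\<pi> j ^ t) :: 'a) * fls_X)"
    define y where "y = VE_rhs (\<lambda>n. fls_const (x n)) v"
    have "monomial_value (\<lambda>j. of_nat (\<pi> j ^ t) :: 'a) n = of_nat (N n ^ t)" for n
      unfolding N_def monomial_value_def by (induction n) (simp_all add: power_mult_distrib)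
    hence val: "monomial_value v n = fls_const (of_nat (N n ^ t)) * fls_X ^ size n" for n
      unfolding v_def monomial_value_scaled by simp
    have dv: "d (fls_const (of_nat a) * fls_X ^ r) = of_nat r * fls_const (\<beta> 1) * (fls_const (of_nat a) * fls_X ^ r)"
      for a r :: nat
      by (simp add: derivation_mult[OF der] d_const d_power derivation_of_nat[OF deriv_\<delta>] mult_ac)
    have d_val: "d (monomial_value v n) = of_nat (size n) * fls_const (\<beta> 1) * monomial_value v n" for n
      unfolding val by (rule dv)
    have "d (v j) = fls_const (\<beta> 1) * v j" for j
      using dv[of "\<pi> j ^ t" 1] by (simp add: v_def)
    hence VE: "d (y i) = VE_rhs (\<lambda>n. fls_const (\<beta> n)) y i" if "1 \<le> i" for i
      by (intro linearisation_solves_VE[OF der d_const \<psi>(1) lin _ _ tr(1) y_def[unfolded x_def] that])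
         (simp_all add: transversal_def)
    have "(\<Sum>n\<in>monomials k. fls_const (\<Sum>l\<in>monomials k. LVE_matrix \<beta> m l * T l n) * monomial_value v n)
        = (\<Sum>l\<in>monomials k. fls_const (LVE_matrix \<beta> m l) *
             (\<Sum>n\<in>monomials k. fls_const (T l n) * monomial_value v n))"
      by (simp add: fls_const_sum sum_distrib_left sum_distrib_right mult.assoc flip: fls_const_mult_const)
         (rule sum.swap)
    also have "\<dots> = (\<Sum>l\<in>monomials k. LVE_matrix (\<lambda>n. fls_const (\<beta> n)) m l * monomial_value y l)"
      by (intro sum.cong refl) (simp add: subst y_def LVE_matrix_fls_const)
    also have "\<dots> = d (monomial_value y m)"
      by (rule LVE_matrix_monomials[OF der VE m, symmetric])
    also have "\<dots> = d (\<Sum>n\<in>monomials k. fls_const (T m n) * monomial_value v n)"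
      by (simp add: subst[OF m] y_def)
    also have "\<dots> = (\<Sum>n\<in>monomials k.
        fls_const (\<delta> (T m n) + of_nat (size n) * \<beta> 1 * T m n) * monomial_value v n)"
      unfolding derivation_sum[OF der]
    proof (intro sum.cong refl)
      fix n
      have "d (fls_const (T m n) * monomial_value v n) = fls_const (\<delta> (T m n)) * monomial_value v n
          + fls_const (T m n) * (of_nat (size n) * fls_const (\<beta> 1) * monomial_value v n)"
        by (simp only: derivation_mult[OF der, of "fls_const (T m n)"] d_const d_val)
      thus "d (fls_const (T m n) * monomial_value v n)
          = fls_const (\<delta> (T m n) + of_nat (size n) * \<beta> 1 * T m n) * monomial_value v n"
        by (simp add: fls_of_nat algebra_simps flip: fls_const_mult_const fls_plus_const)
    qed
    finally show ?thesis
      unfolding C_def val by (simp add: sum_subtractf left_diff_distrib flip: fls_minus_const)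
  qed
  have "C m n = 0" if m: "m \<in> monomials k" and n: "n \<in> monomials k" for m n
  proof -
    let ?a = "\<lambda>l. if size l = size n then C m l else 0"
    have "?a n = 0"
    proof (rule powers_independent[of "monomials k" N ?a n])
      show "inj_on N (monomials k)"
        unfolding N_def using prime_monomial_inj[OF \<pi>] by (rule inj_on_subset) simp
      fix t :: nat
      have "(fls_const (C m l) * (fls_const (of_nat (N l ^ t)) * fls_X ^ size l)) $$ int (size n)
          = ?a l * of_nat (N l ^ t)" for l
        by (simp add: mult.assoc fls_X_power_nth)
      hence "(\<Sum>l\<in>monomials k. ?a l * of_nat (N l ^ t))
          = (\<Sum>l\<in>monomials k. fls_const (C m l) * (fls_const (of_nat (N l ^ t)) * fls_X ^ size l)) $$ int (size n)"
        by (simp only: fls_nth_sum)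
      also have "\<dots> = 0" by (simp only: key[OF m] fls_zero_nth)
      finally show "(\<Sum>l\<in>monomials k. ?a l * of_nat (N l ^ t)) = 0" .
    qed (use n in simp_all)
    thus ?thesis by simp
  qed
  thus ?thesis using TK T1 by (intro exI[of _ T]) (auto simp: C_def)
qed

end

section \<open>Galois groups of diagonalisable systems\<close>

lemma unitriangular_injective:
  fixes T :: "'i \<Rightarrow> 'i \<Rightarrow> 'a::field" and s :: "'i \<Rightarrow> nat"
  assumes fin: "finite I" and s: "\<And>m. m \<in> I \<Longrightarrow> s m \<le> k"
    and T: "\<And>m. m \<in> I \<Longrightarrow> T m m = 1"
      "\<And>m n. m \<in> I \<Longrightarrow> T m n \<noteq> 0 \<Longrightarrow> n = m \<or> s m < s n"
    and 0: "\<And>m. m \<in> I \<Longrightarrow> (\<Sum>n\<in>I. T m n * Z n) = 0" and m: "m \<in> I"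
  shows "Z m = 0"
  using m
proof (induction "k - s m" arbitrary: m rule: less_induct)
  case less
  have "T m n * Z n = 0" if "n \<in> I - {m}" for n
  proof (cases "T m n = 0")
    case False
    hence "s m < s n" using T(2)[OF less.prems] that by blast
    moreover have "s n \<le> k" using s that by blast
    ultimately show ?thesis using less.hyps[of n] that by simp
  qed simp
  hence "(\<Sum>n\<in>I. T m n * Z n) = Z m"
    using fin less.prems by (simp add: sum.remove[of _ m] T sum.neutral)
  thus ?case using 0 less.prems by simp
qed

text \<open>
  The system is solved from the top degree downwards; the division-free recursion keeps the solution in the subfield.
\<close>

lemma unitriangular_surjective:
  fixes T :: "'i \<Rightarrow> 'i \<Rightarrow> 'a::field_char_0" and s :: "'i \<Rightarrow> nat"
  assumes fin: "finite I" and s: "\<And>m. m \<in> I \<Longrightarrow> s m \<le> k"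
    and T: "\<And>m. m \<in> I \<Longrightarrow> T m m = 1"
      "\<And>m n. m \<in> I \<Longrightarrow> T m n \<noteq> 0 \<Longrightarrow> n = m \<or> s m < s n"
    and L: "is_subfield L" "\<And>m n. T m n \<in> L" "\<And>m. m \<in> I \<Longrightarrow> F m \<in> L"
  shows "\<exists>E. \<forall>m\<in>I. E m \<in> L \<and> F m = (\<Sum>n\<in>I. T m n * E n)"
proof -
  interpret subfield L by unfold_locales (rule L(1))
  define R where "R = {(n, m). n \<in> I \<and> s m < s n}"
  define \<Phi> where "\<Phi> = (\<lambda>E m. F m - (\<Sum>n\<in>{n \<in> I. s m < s n}. T m n * E n))"
  have wf: "wf R"
    by (rule wf_subset[OF wf_measure[of "\<lambda>m. k - s m"]]) (use s in \<open>fastforce simp: R_def\<close>)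
  have "\<exists>E. \<forall>m. E m = \<Phi> E m"
    by (rule wf_recursion_exists[OF wf]) (auto simp: \<Phi>_def R_def intro!: sum.cong)
  then obtain E where E: "\<And>m. E m = \<Phi> E m" by blast
  have "E m \<in> L" if "m \<in> I" for m
    using wf that
  proof (induction m rule: wf_induct_rule)
    case (less m)
    have "E n \<in> L" if "n \<in> {n \<in> I. s m < s n}" for n
      using less.IH[of n] that by (simp add: R_def)
    hence "\<Phi> E m \<in> L" unfolding \<Phi>_def using less.prems by (intro diff_in sum_in mult_in L) auto
    thus ?case by (subst E)
  qed
  moreover have "F m = (\<Sum>n\<in>I. T m n * E n)" if m: "m \<in> I" for m
  proof -
    have "(\<Sum>n\<in>I. T m n * E n) = E m + (\<Sum>n\<in>I - {m}. T m n * E n)"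
      using fin m by (simp add: sum.remove[of _ m] T)
    also have "(\<Sum>n\<in>I - {m}. T m n * E n) = (\<Sum>n\<in>{n \<in> I. s m < s n}. T m n * E n)"
      using fin T(2)[OF m] by (intro sum.mono_neutral_right) auto
    also have "E m = F m - (\<Sum>n\<in>{n \<in> I. s m < s n}. T m n * E n)"
      by (subst E) (simp add: \<Phi>_def)
    finally show ?thesis by simp
  qed
  ultimately show ?thesis by blast
qed

lemma (in subfield) is_subfield_coincidence:
  fixes \<sigma> \<tau> :: "'a \<Rightarrow> 'a"
  assumes "\<And>a b. a \<in> K \<Longrightarrow> b \<in> K \<Longrightarrow> \<sigma> (a + b) = \<sigma> a + \<sigma> b \<and> \<sigma> (a * b) = \<sigma> a * \<sigma> b"
    and "\<And>a b. a \<in> K \<Longrightarrow> b \<in> K \<Longrightarrow> \<tau> (a + b) = \<tau> a + \<tau> b \<and> \<tau> (a * b) = \<tau> a * \<tau> b"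
    and 1: "\<sigma> 1 = 1" "\<tau> 1 = 1"
  shows "is_subfield {a \<in> K. \<sigma> a = \<tau> a}"
proof -
  have add: "\<sigma> (a + b) = \<sigma> a + \<sigma> b" "\<tau> (a + b) = \<tau> a + \<tau> b"
    and mult: "\<sigma> (a * b) = \<sigma> a * \<sigma> b" "\<tau> (a * b) = \<tau> a * \<tau> b" if "a \<in> K" "b \<in> K" for a b
    using assms that by blast+
  have 0: "\<sigma> 0 = 0" "\<tau> 0 = 0" using add[of 0 0] by (metis add_cancel_right_right add.right_neutral zero_in)+
  have "\<sigma> (a - b) = \<sigma> a - \<sigma> b" "\<tau> (a - b) = \<tau> a - \<tau> b" if "a \<in> K" "b \<in> K" for a b
    using add[of "a - b" b] diff_in[OF that] that by auto
  moreover have "\<sigma> (inverse a) = inverse (\<sigma> a) \<and> \<tau> (inverse a) = inverse (\<tau> a)" if a: "a \<in> K" for a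
  proof (cases "a = 0")
    case False
    hence "\<sigma> a * \<sigma> (inverse a) = 1" "\<tau> a * \<tau> (inverse a) = 1"
      using a by (simp_all add: 1 inverse_in flip: mult)
    thus ?thesis
      by (simp_all add: inverse_unique)
  qed (simp_all add: 0)
  ultimately show ?thesis
    unfolding is_subfield_def using add mult 0 1 by (auto simp: add_in diff_in mult_in inverse_in)
qed

definition diff_automorphism :: "('a::field \<Rightarrow> 'a) \<Rightarrow> 'a set \<Rightarrow> 'a set \<Rightarrow> ('a \<Rightarrow> 'a) \<Rightarrow> bool" where
  "diff_automorphism \<delta> K L \<sigma> \<longleftrightarrow> \<sigma> \<in> Bij L \<and>
     (\<forall>a\<in>L. \<forall>b\<in>L. \<sigma> (a + b) = \<sigma> a + \<sigma> b \<and> \<sigma> (a * b) = \<sigma> a * \<sigma> b) \<and>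
     (\<forall>a\<in>L. \<sigma> (\<delta> a) = \<delta> (\<sigma> a)) \<and> (\<forall>a\<in>K. \<sigma> a = a)"

lemma group_diff_galois_group:
  assumes L: "is_subfield L" and \<delta>L: "\<And>a. a \<in> L \<Longrightarrow> \<delta> a \<in> L" and KL: "K \<subseteq> L"
  shows "group (diff_galois_group \<delta> K (L :: 'a::field_char_0 set))"
proof -
  interpret L: subfield L by unfold_locales (rule L)
  let ?C = "{\<sigma>. diff_automorphism \<delta> K L \<sigma>}"
  have maps: "\<sigma> a \<in> L" if "\<sigma> \<in> Bij L" "a \<in> L" for \<sigma> a
    using Bij_imp_funcset[OF that(1)] that(2) by blast
  have "subgroup ?C (BijGroup L)"
  proof (rule group.subgroupI[OF group_BijGroup])
    show "?C \<subseteq> carrier (BijGroup L)" by (auto simp: BijGroup_def diff_automorphism_def)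
    have "(\<lambda>x\<in>L. x) \<in> ?C"
      using \<delta>L KL by (auto simp: diff_automorphism_def id_Bij L.add_in L.mult_in)
    thus "?C \<noteq> {}" by blast
  next
    fix \<sigma> assume "\<sigma> \<in> ?C"
    hence \<sigma>: "\<sigma> \<in> Bij L" and hom: "\<And>a b. a \<in> L \<Longrightarrow> b \<in> L \<Longrightarrow> \<sigma> (a + b) = \<sigma> a + \<sigma> b"
        "\<And>a b. a \<in> L \<Longrightarrow> b \<in> L \<Longrightarrow> \<sigma> (a * b) = \<sigma> a * \<sigma> b"
      and \<sigma>\<delta>: "\<And>a. a \<in> L \<Longrightarrow> \<sigma> (\<delta> a) = \<delta> (\<sigma> a)" and \<sigma>K: "\<And>a. a \<in> K \<Longrightarrow> \<sigma> a = a"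
      by (auto simp: diff_automorphism_def)
    let ?i = "inv_into L \<sigma>"
    have bij: "bij_betw \<sigma> L L" using \<sigma> by (simp add: Bij_def)
    have i: "?i a \<in> L" "\<sigma> (?i a) = a" if "a \<in> L" for a
      using bij that by (auto simp: bij_betw_inv_into_right bij_betw_def inv_into_into)
    have i_eq: "?i b = a" if "a \<in> L" "\<sigma> a = b" for a b
      using bij_betw_inv_into_left[OF bij that(1)] that(2) by simp
    have "diff_automorphism \<delta> K L (\<lambda>x\<in>L. ?i x)"
      unfolding diff_automorphism_def
    proof (intro conjI ballI)
      show "(\<lambda>x\<in>L. ?i x) \<in> Bij L" by (rule restrict_inv_into_Bij[OF \<sigma>])
      fix a assume a: "a \<in> L"
      show "(\<lambda>x\<in>L. ?i x) (\<delta> a) = \<delta> ((\<lambda>x\<in>L. ?i x) a)"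
        using a i[OF a] \<delta>L \<sigma>\<delta>[of "?i a"] i_eq[of "\<delta> (?i a)" "\<delta> a"] by simp
      fix b assume b: "b \<in> L"
      show "(\<lambda>x\<in>L. ?i x) (a + b) = (\<lambda>x\<in>L. ?i x) a + (\<lambda>x\<in>L. ?i x) b"
        using a b i[OF a] i[OF b] hom(1)[of "?i a" "?i b"] i_eq[of "?i a + ?i b" "a + b"]
        by (simp add: L.add_in)
      show "(\<lambda>x\<in>L. ?i x) (a * b) = (\<lambda>x\<in>L. ?i x) a * (\<lambda>x\<in>L. ?i x) b"
        using a b i[OF a] i[OF b] hom(2)[of "?i a" "?i b"] i_eq[of "?i a * ?i b" "a * b"]
        by (simp add: L.mult_in)
    next
      fix a assume a: "a \<in> K"
      hence "a \<in> L" using KL by blast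
      thus "(\<lambda>x\<in>L. ?i x) a = a" using i_eq[OF _ \<sigma>K[OF a]] by simp
    qed
    thus "inv\<^bsub>BijGroup L\<^esub> \<sigma> \<in> ?C" by (simp add: inv_BijGroup[OF \<sigma>])
  next
    fix \<sigma> \<tau> assume st: "\<sigma> \<in> ?C" "\<tau> \<in> ?C"
    hence B: "\<sigma> \<in> Bij L" "\<tau> \<in> Bij L" by (auto simp: diff_automorphism_def)
    have "diff_automorphism \<delta> K L (compose L \<sigma> \<tau>)"
      using st maps[OF B(2)] \<delta>L KL
      by (auto simp: diff_automorphism_def compose_Bij compose_eq L.add_in L.mult_in subset_iff)
    thus "\<sigma> \<otimes>\<^bsub>BijGroup L\<^esub> \<tau> \<in> ?C" using B by (simp add: BijGroup_def)
  qed
  hence "group ((BijGroup L)\<lparr>carrier := ?C\<rparr>)"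
    by (rule subgroup.subgroup_is_group) (rule group_BijGroup)
  thus ?thesis by (simp add: diff_galois_group_def diff_automorphism_def)
qed

text \<open>
  Writing the fundamental matrix as \<open>T E\<close> makes the entries of \<open>E\<close> solutions of scalar equations \<open>e' = \<mu> e\<close>. For an
  automorphism \<open>\<sigma>\<close> the quotient \<open>\<sigma> e / e\<close> is a constant, so it lies in \<open>K\<close> and is fixed by all automorphisms. Thus two
  automorphisms commute on generators of the extension.
\<close>

theorem comm_group_diff_galois_group:
  fixes K L :: "'a::field_char_0 set" and T :: "'i \<Rightarrow> 'i \<Rightarrow> 'a" and s :: "'i \<Rightarrow> nat"
  assumes d: "derivation \<delta>" and K: "is_subfield K" and fin: "finite I"
    and pv: "picard_vessiot \<delta> K I A L"
    and s: "\<And>m. m \<in> I \<Longrightarrow> s m \<le> k"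
    and TK: "\<And>m n. T m n \<in> K"
    and T: "\<And>m. m \<in> I \<Longrightarrow> T m m = 1"
      "\<And>m n. m \<in> I \<Longrightarrow> T m n \<noteq> 0 \<Longrightarrow> n = m \<or> s m < s n"
    and gauge: "\<And>m n. m \<in> I \<Longrightarrow> n \<in> I \<Longrightarrow> (\<Sum>l\<in>I. A m l * T l n) = \<delta> (T m n) + \<mu> n * T m n"
    and \<mu>K: "\<And>n. \<mu> n \<in> K"
  shows "comm_group (diff_galois_group \<delta> K L)"
proof -
  obtain F where F: "\<And>i j. i \<in> I \<Longrightarrow> j \<in> I \<Longrightarrow> \<delta> (F i j) = (\<Sum>l\<in>I. A i l * F l j)"
    and \<delta>L: "\<And>a. a \<in> L \<Longrightarrow> \<delta> a \<in> L" and const: "{a \<in> L. \<delta> a = 0} = {a \<in> K. \<delta> a = 0}"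
    and L: "L = is_subfield hull (K \<union> {F i j | i j. i \<in> I \<and> j \<in> I})"
    using pv unfolding picard_vessiot_def by blast
  have subL: "is_subfield L" unfolding L by (rule is_subfield_hull)
  interpret L: subfield L by unfold_locales (rule subL)
  have gen: "K \<union> {F i j | i j. i \<in> I \<and> j \<in> I} \<subseteq> L" unfolding L by (rule hull_subset)
  hence KL: "K \<subseteq> L" and FL: "\<And>i j. i \<in> I \<Longrightarrow> j \<in> I \<Longrightarrow> F i j \<in> L" by auto
  have "\<exists>E. \<forall>m\<in>I. E m \<in> L \<and> F m j = (\<Sum>n\<in>I. T m n * E n)" if "j \<in> I" for j
    using TK KL FL that by (intro unitriangular_surjective[OF fin s T subL]) blast+
  then obtain E where E: "\<And>m j. m \<in> I \<Longrightarrow> j \<in> I \<Longrightarrow> E j m \<in> L"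
      "\<And>m j. m \<in> I \<Longrightarrow> j \<in> I \<Longrightarrow> F m j = (\<Sum>n\<in>I. T m n * E j n)"
    by metis
  have \<delta>E: "\<delta> (E j n) = \<mu> n * E j n" if j: "j \<in> I" and n: "n \<in> I" for j n
  proof -
    have "\<delta> (E j n) - \<mu> n * E j n = 0"
    proof (rule unitriangular_injective[OF fin s T])
      fix m assume m: "m \<in> I"
      have "(\<Sum>n\<in>I. \<delta> (T m n) * E j n + T m n * \<delta> (E j n)) = \<delta> (F m j)"
        unfolding E(2)[OF m j] by (simp add: derivation_sum[OF d] derivation_mult[OF d])
      also have "\<dots> = (\<Sum>l\<in>I. \<Sum>n\<in>I. A m l * (T l n * E j n))"
        unfolding F[OF m j] by (intro sum.cong refl) (simp add: E(2) j sum_distrib_left)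
      also have "\<dots> = (\<Sum>n\<in>I. (\<Sum>l\<in>I. A m l * T l n) * E j n)"
        by (subst sum.swap) (simp add: sum_distrib_right mult.assoc)
      also have "\<dots> = (\<Sum>n\<in>I. \<delta> (T m n) * E j n + T m n * (\<mu> n * E j n))"
        by (intro sum.cong refl) (simp add: gauge[OF m] algebra_simps)
      finally show "(\<Sum>n\<in>I. T m n * (\<delta> (E j n) - \<mu> n * E j n)) = 0"
        by (simp add: sum.distrib right_diff_distrib sum_subtractf)
    qed (use n in auto)
    thus ?thesis by simp
  qed
  have scale: "\<exists>z\<in>K. \<sigma> (E j n) = z * E j n"
    if \<sigma>: "diff_automorphism \<delta> K L \<sigma>" and j: "j \<in> I" and n: "n \<in> I" for \<sigma> j n
  proof (cases "E j n = 0")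
    case True
    have "0 \<in> K" using K by (simp add: is_subfield_def)
    thus ?thesis using True \<sigma> by (auto simp: diff_automorphism_def)
  next
    case False
    let ?e = "E j n"
    have e: "?e \<in> L" "\<sigma> ?e \<in> L"
      using E j n \<sigma> Bij_imp_funcset[of \<sigma> L] by (auto simp: diff_automorphism_def)
    have "\<delta> (\<sigma> ?e) = \<sigma> (\<mu> n * ?e)"
      using \<sigma> e by (simp add: diff_automorphism_def \<delta>E[OF j n, symmetric])
    also have "\<dots> = \<mu> n * \<sigma> ?e"
    proof -
      have "\<mu> n \<in> L" "\<sigma> (\<mu> n) = \<mu> n" using \<mu>K KL \<sigma> by (auto simp: diff_automorphism_def)
      moreover from this have "\<sigma> (\<mu> n * ?e) = \<sigma> (\<mu> n) * \<sigma> ?e"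
        using \<sigma> e(1) by (simp add: diff_automorphism_def)
      ultimately show ?thesis by simp
    qed
    finally have "\<delta> (\<sigma> ?e / ?e) = 0"
      using False by (simp add: derivation_divide[OF d False] \<delta>E[OF j n])
    hence "\<sigma> ?e / ?e \<in> K" using const L.divide_in[OF e(2,1)] by blast
    thus ?thesis using False by (intro bexI[of _ "\<sigma> ?e / ?e"]) simp_all
  qed
  have commute: "\<sigma> (\<tau> a) = \<tau> (\<sigma> a)"
    if \<sigma>: "diff_automorphism \<delta> K L \<sigma>" and \<tau>: "diff_automorphism \<delta> K L \<tau>" and a: "a \<in> L" for \<sigma> \<tau> a
  proof -
    have hom: "\<rho> (a + b) = \<rho> a + \<rho> b" "\<rho> (a * b) = \<rho> a * \<rho> b"
      if "diff_automorphism \<delta> K L \<rho>" "a \<in> L" "b \<in> L" for \<rho> a b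
      using that by (auto simp: diff_automorphism_def)
    have fixed: "\<rho> a = a" if "diff_automorphism \<delta> K L \<rho>" "a \<in> K" for \<rho> a
      using that by (auto simp: diff_automorphism_def)
    have maps: "\<rho> a \<in> L" if "diff_automorphism \<delta> K L \<rho>" "a \<in> L" for \<rho> a
      using that Bij_imp_funcset[of \<rho> L] by (auto simp: diff_automorphism_def)
    have one: "\<sigma> 1 = 1" "\<tau> 1 = 1"
      using fixed \<sigma> \<tau> K unfolding is_subfield_def by blast+
    let ?S = "{a \<in> L. \<sigma> (\<tau> a) = \<tau> (\<sigma> a)}"
    have S: "is_subfield ?S"
      by (rule L.is_subfield_coincidence) (use hom maps one \<sigma> \<tau> in simp_all)
    interpret S: subfield ?S by unfold_locales (rule S)
    have KS: "K \<subseteq> ?S" using KL fixed[OF \<sigma>] fixed[OF \<tau>] by auto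
    have ES: "E j n \<in> ?S" if j: "j \<in> I" and n: "n \<in> I" for j n
    proof -
      obtain y z where yz: "y \<in> K" "\<sigma> (E j n) = y * E j n" "z \<in> K" "\<tau> (E j n) = z * E j n"
        using scale[OF \<sigma> j n] scale[OF \<tau> j n] by blast
      have "\<sigma> (z * E j n) = z * (y * E j n)" "\<tau> (y * E j n) = y * (z * E j n)"
        using hom(2)[OF \<sigma> _ E(1)[OF n j], of z] hom(2)[OF \<tau> _ E(1)[OF n j], of y]
          fixed[OF \<sigma> yz(3)] fixed[OF \<tau> yz(1)] yz KL by (simp_all add: subset_iff)
      thus ?thesis using E(1)[OF n j] yz by (simp add: mult.left_commute)
    qed
    have "F i j \<in> ?S" if "i \<in> I" "j \<in> I" for i j
      unfolding E(2)[OF that] using that TK KS ES by (intro S.sum_in S.mult_in) blast+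
    hence "L \<subseteq> ?S"
      unfolding L using KS S by (intro hull_minimal) (auto simp flip: L)
    thus ?thesis using a by blast
  qed
  interpret G: group "diff_galois_group \<delta> K L"
    by (rule group_diff_galois_group[OF subL \<delta>L KL])
  show ?thesis
  proof (rule G.group_comm_groupI)
    fix \<sigma> \<tau> assume st: "\<sigma> \<in> carrier (diff_galois_group \<delta> K L)" "\<tau> \<in> carrier (diff_galois_group \<delta> K L)"
    hence st': "diff_automorphism \<delta> K L \<sigma>" "diff_automorphism \<delta> K L \<tau>" "\<sigma> \<in> Bij L" "\<tau> \<in> Bij L"
      by (auto simp: diff_galois_group_def diff_automorphism_def)
    have "compose L \<sigma> \<tau> = compose L \<tau> \<sigma>"
      unfolding compose_def by (rule restrict_ext) (rule commute[OF st'(1,2)])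
    thus "\<sigma> \<otimes>\<^bsub>diff_galois_group \<delta> K L\<^esub> \<tau> = \<tau> \<otimes>\<^bsub>diff_galois_group \<delta> K L\<^esub> \<sigma>"
      using st'(3,4) by (simp add: diff_galois_group_def BijGroup_def)
  qed
qed

theorem theoremB:
  fixes P Q :: "complex poly poly"
    and U :: "complex set" and \<phi> :: "complex \<Rightarrow> complex"
    and \<delta> :: "'a::field_char_0 \<Rightarrow> 'a" and c :: "complex \<Rightarrow> 'a" and \<xi> \<eta> :: 'a
    and k :: nat and L :: "'a set"
  assumes "algebraic_function_on U \<phi>"
    and "invariant_graph P Q U \<phi>"
    and "VE1_irregular_at_infinity (Fract Q P) U \<phi>"
    and "rationally_integrable (Fract P 1, Fract Q 1)"
    and "k \<ge> 1"
    and "realizes_curve_field U \<phi> \<delta> c \<xi> \<eta>"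
    and "picard_vessiot \<delta> (curve_field c \<xi> \<eta>) (monomials k)
           (LVE_matrix (beta (Fract Q P) c \<xi> \<eta>)) L"
  shows "comm_group (diff_galois_group \<delta> (curve_field c \<xi> \<eta>) L)"
proof -
  interpret irregular_curve P Q U \<phi> \<delta> c \<xi> \<eta>
    by unfold_locales (fact assms)+
  obtain T where T: "(\<forall>m n. T m n \<in> K) \<and>
    (\<forall>m\<in>monomials k. T m m = 1 \<and> (\<forall>n. T m n \<noteq> 0 \<longrightarrow> n = m \<or> size m < size n)) \<and>
    (\<forall>m\<in>monomials k. \<forall>n\<in>monomials k.
       (\<Sum>l\<in>monomials k. LVE_matrix \<beta> m l * T l n) = \<delta> (T m n) + of_nat (size n) * \<beta> 1 * T m n)"
    using LVE_diagonalisable[OF assms(4), of k] by (elim exE)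
  show ?thesis
  proof (rule comm_group_diff_galois_group[OF deriv_\<delta> is_subfield_K finite_monomials assms(7),
        where T = T and s = size and \<mu> = "\<lambda>n. of_nat (size n) * \<beta> 1"])
    show "of_nat (size n) * \<beta> 1 \<in> K" for n :: "nat multiset"
      by (intro K.mult_in K.of_nat_in \<beta>_1_in_K)
  qed (use T monomials_size_le in simp_all)
qed

end
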